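(* Let $C$ and $D$ be coalgebras over a field $k$. Let $\chi: C\otimes D\to D\otimes C$ be a twist map satisfying the coassociativity condition, and let $\Psi'\in\mathsf{Tw}$. Then the twist map $\chi_\Psi:=\Psi'\circ\chi: C\otimes D\to D\otimes C$ also satisfies the coassociativity condition.
   Context: All coalgebras are coassociative and counital over the field $k$. A twist map is a $k$-linear map $\Psi: C\otimes D\to D\otimes C$. It satisfies the coassociativity condition if $$(\mathrm{id}_D\otimes\mathrm{id}_C\otimes\Psi)(\mathrm{id}_D\otimes\Delta_C\otimes\mathrm{id}_D)(\Psi\otimes\mathrm{id}_D)(\mathrm{id}_C\otimes\Delta_D)=(\Psi\otimes\mathrm{id}_D\otimes\mathrm{id}_C)(\mathrm{id}_C\otimes\Delta_D\otimes\mathrm{id}_C)(\mathrm{id}_C\otimes\Psi)(\Delta_C\otimes\mathrm{id}_D).$$ $\mathsf{Tw}$ is the set of $k$-linear maps $\Psi': D\otimes C\to D\otimes C$ with $(\Delta_D\otimes\mathrm{id}_C)\Psi'=(\mathrm{id}_D\otimes\Psi')(\Delta_D\otimes\mathrm{id}_C)$ and $(\mathrm{id}_D\otimes\Delta_C)\Psi'=(\Psi'\otimes\mathrm{id}_C)(\mathrm{id}_D\otimes\Delta_C)$. *)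

theory Defs
  imports "HOL-Algebra.AbelCoset" "Jordan_Normal_Form.Missing_VectorSpace"
begin

section \<open>Tensor products of modules\<close>

definition free_module :: "('a, 'k) ring_scheme \<Rightarrow> 'i set \<Rightarrow> ('a, 'i \<Rightarrow> 'a) module"
  where "free_module K I = (ring.func_space K I)
    \<lparr>carrier := {p \<in> I \<rightarrow>\<^sub>E carrier K. finite {i \<in> I. p i \<noteq> \<zero>\<^bsub>K\<^esub>}}\<rparr>"

definition free_gen :: "('a, 'k) ring_scheme \<Rightarrow> 'i set \<Rightarrow> 'i \<Rightarrow> ('i \<Rightarrow> 'a)"
  where "free_gen K I j = (\<lambda>i\<in>I. if i = j then \<one>\<^bsub>K\<^esub> else \<zero>\<^bsub>K\<^esub>)"

(* The ring multiplication inherited by the module record plays no role in a module; it is set to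
   a dummy value. Scaling is the union over a coset so that scaling by zero gives the coset W. *)
definition quotient_module :: "('a, 'c, 'e) module_scheme \<Rightarrow> 'c set \<Rightarrow> ('a, 'c set) module"
  where "quotient_module M W =
    \<lparr>carrier = a_rcosets\<^bsub>M\<^esub> W, mult = (\<lambda>X Y. W), one = W, zero = W,
     add = (\<lambda>X Y. X <+>\<^bsub>M\<^esub> Y), smult = (\<lambda>a X. \<Union>x\<in>X. W +>\<^bsub>M\<^esub> (a \<odot>\<^bsub>M\<^esub> x))\<rparr>"

definition bilinear_relations ::
  "('a, 'k) ring_scheme \<Rightarrow> ('a, 'm, 'e) module_scheme \<Rightarrow> ('a, 'n, 'f) module_scheme
    \<Rightarrow> ('m \<times> 'n \<Rightarrow> 'a) set"
  where "bilinear_relations K M N =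
    (let I = carrier M \<times> carrier N; F = free_module K I; d = (\<lambda>m n. free_gen K I (m, n)) in
      {d (m \<oplus>\<^bsub>M\<^esub> m') n \<ominus>\<^bsub>F\<^esub> (d m n \<oplus>\<^bsub>F\<^esub> d m' n) | m m' n.
        m \<in> carrier M \<and> m' \<in> carrier M \<and> n \<in> carrier N} \<union>
      {d m (n \<oplus>\<^bsub>N\<^esub> n') \<ominus>\<^bsub>F\<^esub> (d m n \<oplus>\<^bsub>F\<^esub> d m n') | m n n'.
        m \<in> carrier M \<and> n \<in> carrier N \<and> n' \<in> carrier N} \<union>
      {d (a \<odot>\<^bsub>M\<^esub> m) n \<ominus>\<^bsub>F\<^esub> (a \<odot>\<^bsub>F\<^esub> d m n) | a m n.
        a \<in> carrier K \<and> m \<in> carrier M \<and> n \<in> carrier N} \<union>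
      {d m (a \<odot>\<^bsub>N\<^esub> n) \<ominus>\<^bsub>F\<^esub> (a \<odot>\<^bsub>F\<^esub> d m n) | a m n.
        a \<in> carrier K \<and> m \<in> carrier M \<and> n \<in> carrier N})"

definition tensor_kernel ::
  "('a, 'k) ring_scheme \<Rightarrow> ('a, 'm, 'e) module_scheme \<Rightarrow> ('a, 'n, 'f) module_scheme
    \<Rightarrow> ('m \<times> 'n \<Rightarrow> 'a) set"
  where "tensor_kernel K M N =
    module.span K (free_module K (carrier M \<times> carrier N)) (bilinear_relations K M N)"

type_synonym ('a, 'm, 'n) tensor = "('m \<times> 'n \<Rightarrow> 'a) set"

definition tensor ::
  "('a, 'k) ring_scheme \<Rightarrow> ('a, 'm, 'e) module_scheme \<Rightarrow> ('a, 'n, 'f) module_scheme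
    \<Rightarrow> ('a, ('a, 'm, 'n) tensor) module"
  where "tensor K M N =
    quotient_module (free_module K (carrier M \<times> carrier N)) (tensor_kernel K M N)"

abbreviation tensor_syntax (\<open>(_ \<Otimes>[_] _)\<close> [71, 0, 70] 70)
  where "M \<Otimes>[K] N \<equiv> tensor K M N"

definition pure_tensor ::
  "('a, 'k) ring_scheme \<Rightarrow> ('a, 'm, 'e) module_scheme \<Rightarrow> ('a, 'n, 'f) module_scheme
    \<Rightarrow> 'm \<Rightarrow> 'n \<Rightarrow> ('a, 'm, 'n) tensor"
  where "pure_tensor K M N m n =
    tensor_kernel K M N +>\<^bsub>free_module K (carrier M \<times> carrier N)\<^esub>
      free_gen K (carrier M \<times> carrier N) (m, n)"

definition bilinear_map ::
  "('a, 'k) ring_scheme \<Rightarrow> ('a, 'm, 'e) module_scheme \<Rightarrow> ('a, 'n, 'f) module_scheme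
    \<Rightarrow> ('a, 'p, 'g) module_scheme \<Rightarrow> ('m \<Rightarrow> 'n \<Rightarrow> 'p) \<Rightarrow> bool"
  where "bilinear_map K M N P \<beta> \<longleftrightarrow>
    (\<forall>m\<in>carrier M. \<beta> m \<in> module_hom K N P) \<and>
    (\<forall>n\<in>carrier N. (\<lambda>m. \<beta> m n) \<in> module_hom K M P)"

(* The linear map on the tensor product induced by a bilinear map, computed on an arbitrary
   representative. That this is well defined, and the only linear map taking m \<otimes> n to \<beta> m n,
   is tensor_lift_hom, tensor_lift_pure and tensor_hom_eqI below. *)
definition tensor_lift ::
  "('a, 'k) ring_scheme \<Rightarrow> ('a, 'm, 'e) module_scheme \<Rightarrow> ('a, 'n, 'f) module_scheme
    \<Rightarrow> ('a, 'p, 'g) module_scheme \<Rightarrow> ('m \<Rightarrow> 'n \<Rightarrow> 'p) \<Rightarrow> ('a, 'm, 'n) tensor \<Rightarrow> 'p"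
  where "tensor_lift K M N P \<beta> X =
    (let p = (SOME p. p \<in> X) in
      \<Oplus>\<^bsub>P\<^esub>i\<in>{i \<in> carrier M \<times> carrier N. p i \<noteq> \<zero>\<^bsub>K\<^esub>}. p i \<odot>\<^bsub>P\<^esub> \<beta> (fst i) (snd i))"

definition tensor_map ::
  "('a, 'k) ring_scheme \<Rightarrow> ('a, 'm, 'e) module_scheme \<Rightarrow> ('a, 'n, 'f) module_scheme
    \<Rightarrow> ('a, 'p, 'g) module_scheme \<Rightarrow> ('a, 'q, 'h) module_scheme
    \<Rightarrow> ('m \<Rightarrow> 'p) \<Rightarrow> ('n \<Rightarrow> 'q) \<Rightarrow> ('a, 'm, 'n) tensor \<Rightarrow> ('a, 'p, 'q) tensor"
  where "tensor_map K M N P Q f g =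
    tensor_lift K M N (P \<Otimes>[K] Q) (\<lambda>m n. pure_tensor K P Q (f m) (g n))"

definition associator ::
  "('a, 'k) ring_scheme \<Rightarrow> ('a, 'l, 'e) module_scheme \<Rightarrow> ('a, 'm, 'f) module_scheme
    \<Rightarrow> ('a, 'n, 'g) module_scheme
    \<Rightarrow> ('a, ('a, 'l, 'm) tensor, 'n) tensor \<Rightarrow> ('a, 'l, ('a, 'm, 'n) tensor) tensor"
  where "associator K L M N =
    tensor_lift K (L \<Otimes>[K] M) N (L \<Otimes>[K] (M \<Otimes>[K] N))
      (\<lambda>x n. tensor_lift K L M (L \<Otimes>[K] (M \<Otimes>[K] N))
        (\<lambda>l m. pure_tensor K L (M \<Otimes>[K] N) l (pure_tensor K M N m n)) x)"

definition associator_inv ::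
  "('a, 'k) ring_scheme \<Rightarrow> ('a, 'l, 'e) module_scheme \<Rightarrow> ('a, 'm, 'f) module_scheme
    \<Rightarrow> ('a, 'n, 'g) module_scheme
    \<Rightarrow> ('a, 'l, ('a, 'm, 'n) tensor) tensor \<Rightarrow> ('a, ('a, 'l, 'm) tensor, 'n) tensor"
  where "associator_inv K L M N =
    tensor_lift K L (M \<Otimes>[K] N) ((L \<Otimes>[K] M) \<Otimes>[K] N)
      (\<lambda>l y. tensor_lift K M N ((L \<Otimes>[K] M) \<Otimes>[K] N)
        (\<lambda>m n. pure_tensor K (L \<Otimes>[K] M) N (pure_tensor K L M l m) n) y)"

section \<open>Coalgebras\<close>

definition base_module :: "('a, 'k) ring_scheme \<Rightarrow> ('a, 'a) module"
  where "base_module K =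
    \<lparr>carrier = carrier K, mult = mult K, one = one K, zero = zero K, add = add K,
     smult = mult K\<rparr>"

record ('a, 'c) coalgebra = "('a, 'c) module" +
  comult :: "'c \<Rightarrow> ('a, 'c, 'c) tensor"
  counit :: "'c \<Rightarrow> 'a"

(* The counit axioms use the canonical identifications of K \<otimes> C and C \<otimes> K with C. *)
locale coalgebra = vectorspace K C
  for K :: "('a, 'k) ring_scheme" and C :: "('a, 'c, 'e) coalgebra_scheme" (structure) +
  assumes comult_hom: "comult C \<in> module_hom K C (C \<Otimes>[K] C)"
    and counit_hom: "counit C \<in> module_hom K C (base_module K)"
    and coassoc: "c \<in> carrier C \<Longrightarrow>
      associator K C C C (tensor_map K C C (C \<Otimes>[K] C) C (comult C) id (comult C c)) =
      tensor_map K C C C (C \<Otimes>[K] C) id (comult C) (comult C c)"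
    and counit_left: "c \<in> carrier C \<Longrightarrow>
      tensor_lift K (base_module K) C C (\<lambda>a x. a \<odot>\<^bsub>C\<^esub> x)
        (tensor_map K C C (base_module K) C (counit C) id (comult C c)) = c"
    and counit_right: "c \<in> carrier C \<Longrightarrow>
      tensor_lift K C (base_module K) C (\<lambda>x a. a \<odot>\<^bsub>C\<^esub> x)
        (tensor_map K C C C (base_module K) id (counit C) (comult C c)) = c"

section \<open>Twist maps\<close>

definition twist_map ::
  "('a, 'k) ring_scheme \<Rightarrow> ('a, 'c, 'e) coalgebra_scheme \<Rightarrow> ('a, 'd, 'f) coalgebra_scheme
    \<Rightarrow> (('a, 'c, 'd) tensor \<Rightarrow> ('a, 'd, 'c) tensor) \<Rightarrow> bool"
  where "twist_map K C D \<Psi> \<longleftrightarrow> \<Psi> \<in> module_hom K (C \<Otimes>[K] D) (D \<Otimes>[K] C)"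

(* Iterated tensor products are bracketed to the right, so both sides below are maps from
   C \<otimes> D to D \<otimes> (C \<otimes> (D \<otimes> C)); the associators only move brackets. *)
definition twist_coassociative ::
  "('a, 'k) ring_scheme \<Rightarrow> ('a, 'c, 'e) coalgebra_scheme \<Rightarrow> ('a, 'd, 'f) coalgebra_scheme
    \<Rightarrow> (('a, 'c, 'd) tensor \<Rightarrow> ('a, 'd, 'c) tensor) \<Rightarrow> bool"
  where "twist_coassociative K C D \<Psi> \<longleftrightarrow> (\<forall>x\<in>carrier (C \<Otimes>[K] D).
    (tensor_map K D (C \<Otimes>[K] (C \<Otimes>[K] D)) D (C \<Otimes>[K] (D \<Otimes>[K] C)) id
        (tensor_map K C (C \<Otimes>[K] D) C (D \<Otimes>[K] C) id \<Psi>)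
     \<circ> tensor_map K D ((C \<Otimes>[K] C) \<Otimes>[K] D) D (C \<Otimes>[K] (C \<Otimes>[K] D)) id
        (associator K C C D)
     \<circ> tensor_map K D (C \<Otimes>[K] D) D ((C \<Otimes>[K] C) \<Otimes>[K] D) id
        (tensor_map K C D (C \<Otimes>[K] C) D (comult C) id)
     \<circ> associator K D C D
     \<circ> tensor_map K (C \<Otimes>[K] D) D (D \<Otimes>[K] C) D \<Psi> id
     \<circ> associator_inv K C D D
     \<circ> tensor_map K C D C (D \<Otimes>[K] D) id (comult D)) x =
    (associator K D C (D \<Otimes>[K] C)
     \<circ> tensor_map K (C \<Otimes>[K] D) (D \<Otimes>[K] C) (D \<Otimes>[K] C) (D \<Otimes>[K] C) \<Psi> id
     \<circ> associator_inv K C D (D \<Otimes>[K] C)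
     \<circ> tensor_map K C ((D \<Otimes>[K] D) \<Otimes>[K] C) C (D \<Otimes>[K] (D \<Otimes>[K] C)) id
        (associator K D D C)
     \<circ> tensor_map K C (D \<Otimes>[K] C) C ((D \<Otimes>[K] D) \<Otimes>[K] C) id
        (tensor_map K D C (D \<Otimes>[K] D) C (comult D) id)
     \<circ> tensor_map K C (C \<Otimes>[K] D) C (D \<Otimes>[K] C) id \<Psi>
     \<circ> associator K C C D
     \<circ> tensor_map K C D (C \<Otimes>[K] C) D (comult C) id) x)"

definition Tw ::
  "('a, 'k) ring_scheme \<Rightarrow> ('a, 'c, 'e) coalgebra_scheme \<Rightarrow> ('a, 'd, 'f) coalgebra_scheme
    \<Rightarrow> (('a, 'd, 'c) tensor \<Rightarrow> ('a, 'd, 'c) tensor) set"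
  where "Tw K C D = {\<Psi> \<in> module_hom K (D \<Otimes>[K] C) (D \<Otimes>[K] C). \<forall>x\<in>carrier (D \<Otimes>[K] C).
    (associator K D D C
     \<circ> tensor_map K D C (D \<Otimes>[K] D) C (comult D) id
     \<circ> \<Psi>) x =
    (tensor_map K D (D \<Otimes>[K] C) D (D \<Otimes>[K] C) id \<Psi>
     \<circ> associator K D D C
     \<circ> tensor_map K D C (D \<Otimes>[K] D) C (comult D) id) x \<and>
    (tensor_map K D C D (C \<Otimes>[K] C) id (comult C)
     \<circ> \<Psi>) x =
    (associator K D C C
     \<circ> tensor_map K (D \<Otimes>[K] C) C (D \<Otimes>[K] C) C \<Psi> id
     \<circ> associator_inv K D C C
     \<circ> tensor_map K D C D (C \<Otimes>[K] C) id (comult C)) x}"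

section \<open>The universal property of the tensor product\<close>

lemma free_module_simps:
  assumes "ring K"
  shows "carrier (free_module K I) = {p \<in> I \<rightarrow>\<^sub>E carrier K. finite {i \<in> I. p i \<noteq> \<zero>\<^bsub>K\<^esub>}}"
    and "zero (free_module K I) = (\<lambda>i\<in>I. \<zero>\<^bsub>K\<^esub>)"
    and "add (free_module K I) = (\<lambda>p q. \<lambda>i\<in>I. p i \<oplus>\<^bsub>K\<^esub> q i)"
    and "smult (free_module K I) = (\<lambda>a p. \<lambda>i\<in>I. a \<otimes>\<^bsub>K\<^esub> p i)"
  by (simp_all add: free_module_def ring.func_space_def[OF assms])

lemma free_module_module:
  assumes "cring K"
  shows "module K (free_module K I)"
proof -
  interpret cring K by fact
  interpret F: module K "func_space I" by (rule func_space_is_module)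
  have "LinearCombinations.submodule K (carrier (free_module K I)) (func_space I)"
  proof (unfold_locales, goal_cases)
    case 1
    then show ?case by (auto simp: free_module_simps[OF ring_axioms] func_space_def)
  next
    case (2 p q)
    have "{i \<in> I. p i \<oplus>\<^bsub>K\<^esub> q i \<noteq> \<zero>\<^bsub>K\<^esub>} \<subseteq> {i \<in> I. p i \<noteq> \<zero>\<^bsub>K\<^esub>} \<union> {i \<in> I. q i \<noteq> \<zero>\<^bsub>K\<^esub>}"
      by auto
    then have "finite {i \<in> I. p i \<oplus>\<^bsub>K\<^esub> q i \<noteq> \<zero>\<^bsub>K\<^esub>}"
      using 2 by (auto simp: free_module_simps[OF ring_axioms] elim: finite_subset)
    then show ?case
      using 2 by (auto simp: free_module_simps[OF ring_axioms] func_space_def PiE_iff cong: conj_cong)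
  next
    case 3
    then show ?case by (auto simp: free_module_simps[OF ring_axioms] func_space_def cong: conj_cong)
  next
    case (4 a p)
    have "{i \<in> I. a \<otimes>\<^bsub>K\<^esub> p i \<noteq> \<zero>\<^bsub>K\<^esub>} \<subseteq> {i \<in> I. p i \<noteq> \<zero>\<^bsub>K\<^esub>}"
      using 4 by auto
    then have "finite {i \<in> I. a \<otimes>\<^bsub>K\<^esub> p i \<noteq> \<zero>\<^bsub>K\<^esub>}"
      using 4 by (auto simp: free_module_simps[OF ring_axioms] elim: finite_subset)
    then show ?case
      using 4 by (auto simp: free_module_simps[OF ring_axioms] func_space_def PiE_iff cong: conj_cong)
  qed
  from F.submodule_is_module[OF this] show ?thesis
    by (simp add: free_module_def func_space_def)
qed

lemma free_gen_closed:
  assumes "cring K" "j \<in> I"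
  shows "free_gen K I j \<in> carrier (free_module K I)"
proof -
  interpret cring K by fact
  have "{i \<in> I. free_gen K I j i \<noteq> \<zero>\<^bsub>K\<^esub>} \<subseteq> {j}"
    by (auto simp: free_gen_def)
  then have "finite {i \<in> I. free_gen K I j i \<noteq> \<zero>\<^bsub>K\<^esub>}"
    by (rule finite_subset) simp
  then show ?thesis
    by (simp add: free_module_simps[OF ring_axioms]) (simp add: free_gen_def)
qed

lemma submodule_abelian_subgroup:
  assumes "LinearCombinations.submodule K W M"
  shows "abelian_subgroup W M"
proof -
  interpret W: LinearCombinations.submodule K W M by fact
  interpret M: module K M by (rule W.module)
  show ?thesis
  proof (rule abelian_subgroupI3)
    show "additive_subgroup W M"
    proof (intro additive_subgroup.intro subgroup.intro)
      fix x assume x: "x \<in> W"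
      then have "(\<ominus>\<^bsub>K\<^esub> \<one>\<^bsub>K\<^esub>) \<odot>\<^bsub>M\<^esub> x = \<ominus>\<^bsub>M\<^esub> x"
        using W.subset M.smult_l_minus[of "\<one>\<^bsub>K\<^esub>" x] by auto
      then show "inv\<^bsub>add_monoid M\<^esub> x \<in> W"
        using W.smult_closed[OF _ x, of "\<ominus>\<^bsub>K\<^esub> \<one>\<^bsub>K\<^esub>"] by (simp add: a_inv_def)
    qed (use W.subset in auto)
    show "abelian_group M" ..
  qed
qed

lemma quotient_smult:
  assumes "LinearCombinations.submodule K W M" "a \<in> carrier K" "x \<in> carrier M"
  shows "a \<odot>\<^bsub>quotient_module M W\<^esub> (W +>\<^bsub>M\<^esub> x) = W +>\<^bsub>M\<^esub> (a \<odot>\<^bsub>M\<^esub> x)"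
proof -
  interpret W: LinearCombinations.submodule K W M by fact
  interpret M: module K M by (rule W.module)
  interpret A: abelian_subgroup W M by (rule submodule_abelian_subgroup) fact
  have "W +>\<^bsub>M\<^esub> (a \<odot>\<^bsub>M\<^esub> y) = W +>\<^bsub>M\<^esub> (a \<odot>\<^bsub>M\<^esub> x)" if y: "y \<in> W +>\<^bsub>M\<^esub> x" for y
  proof -
    obtain w where w: "w \<in> W" "y = w \<oplus>\<^bsub>M\<^esub> x"
      using y by (auto simp: a_r_coset_def r_coset_def)
    have "a \<odot>\<^bsub>M\<^esub> y \<in> W +>\<^bsub>M\<^esub> (a \<odot>\<^bsub>M\<^esub> x)"
      using w assms W.subset
      by (auto simp: a_r_coset_def r_coset_def M.smult_r_distr subset_iff)
    then show ?thesis
      using M.a_repr_independence[OF _ _ A.a_subgroup] assms(2,3) by auto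
  qed
  moreover have "x \<in> W +>\<^bsub>M\<^esub> x"
    using assms(3) by (rule A.a_rcos_self)
  ultimately have "(\<Union>y\<in>W +>\<^bsub>M\<^esub> x. W +>\<^bsub>M\<^esub> (a \<odot>\<^bsub>M\<^esub> y)) = W +>\<^bsub>M\<^esub> (a \<odot>\<^bsub>M\<^esub> x)"
    by blast
  then show ?thesis
    by (simp add: quotient_module_def)
qed

lemma quotient_simps:
  "carrier (quotient_module M W) = a_rcosets\<^bsub>M\<^esub> W"
  "zero (quotient_module M W) = W"
  "add (quotient_module M W) = (\<lambda>X Y. X <+>\<^bsub>M\<^esub> Y)"
  by (simp_all add: quotient_module_def)

lemma quotient_module_module:
  assumes "LinearCombinations.submodule K W M"
  shows "module K (quotient_module M W)"
proof -
  interpret W: LinearCombinations.submodule K W M by fact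
  interpret M: module K M by (rule W.module)
  interpret A: abelian_subgroup W M by (rule submodule_abelian_subgroup) fact
  have ex: "\<exists>x\<in>carrier M. X = W +>\<^bsub>M\<^esub> x" if "X \<in> a_rcosets\<^bsub>M\<^esub> W" for X
    using that by (auto simp: A_RCOSETS_def RCOSETS_def a_r_coset_def)
  have W0: "W = W +>\<^bsub>M\<^esub> \<zero>\<^bsub>M\<^esub>"
    using W.subset by simp
  have ab: "abelian_group (quotient_module M W)"
  proof (rule abelian_groupI, unfold quotient_simps)
    fix X Y assume X: "X \<in> a_rcosets\<^bsub>M\<^esub> W" and Y: "Y \<in> a_rcosets\<^bsub>M\<^esub> W"
    then show "X <+>\<^bsub>M\<^esub> Y \<in> a_rcosets\<^bsub>M\<^esub> W"
      by (rule A.a_setmult_closed)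
    show "X <+>\<^bsub>M\<^esub> Y = Y <+>\<^bsub>M\<^esub> X"
      using ex[OF X] ex[OF Y] by (auto simp: A.a_rcos_sum M.a_comm)
    show "X <+>\<^bsub>M\<^esub> Y <+>\<^bsub>M\<^esub> Z = X <+>\<^bsub>M\<^esub> (Y <+>\<^bsub>M\<^esub> Z)" if "Z \<in> a_rcosets\<^bsub>M\<^esub> W" for Z
      using X Y that by (rule A.a_rcosets_assoc)
    show "W <+>\<^bsub>M\<^esub> X = X"
      using X by (rule A.rcosets_add_eq)
    obtain x where x: "x \<in> carrier M" "X = W +>\<^bsub>M\<^esub> x"
      using ex[OF X] by auto
    have "(W +>\<^bsub>M\<^esub> (\<ominus>\<^bsub>M\<^esub> x)) <+>\<^bsub>M\<^esub> X = W"
      using x A.a_rcos_sum[of "\<ominus>\<^bsub>M\<^esub> x" x] W0 by (simp add: M.l_neg)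
    then show "\<exists>Y\<in>a_rcosets\<^bsub>M\<^esub> W. Y <+>\<^bsub>M\<^esub> X = W"
      using M.a_rcosetsI[OF W.subset, of "\<ominus>\<^bsub>M\<^esub> x"] x(1) by auto
  qed (rule A.a_subgroup_in_rcosets)
  note smult = quotient_smult[OF assms]
  show ?thesis
  proof (rule moduleI[OF M.R.is_cring ab], unfold quotient_simps)
    fix a X assume "a \<in> carrier K" "X \<in> a_rcosets\<^bsub>M\<^esub> W"
    then show "a \<odot>\<^bsub>quotient_module M W\<^esub> X \<in> a_rcosets\<^bsub>M\<^esub> W"
      using ex[of X] smult M.a_rcosetsI[OF W.subset] by auto
  next
    fix a b X assume "a \<in> carrier K" "b \<in> carrier K" "X \<in> a_rcosets\<^bsub>M\<^esub> W"
    then show "(a \<oplus>\<^bsub>K\<^esub> b) \<odot>\<^bsub>quotient_module M W\<^esub> X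
        = a \<odot>\<^bsub>quotient_module M W\<^esub> X <+>\<^bsub>M\<^esub> b \<odot>\<^bsub>quotient_module M W\<^esub> X"
      and "(a \<otimes>\<^bsub>K\<^esub> b) \<odot>\<^bsub>quotient_module M W\<^esub> X
        = a \<odot>\<^bsub>quotient_module M W\<^esub> (b \<odot>\<^bsub>quotient_module M W\<^esub> X)"
      using ex[of X] smult A.a_rcos_sum by (auto simp: M.smult_l_distr M.smult_assoc1)
  next
    fix a X Y assume "a \<in> carrier K" "X \<in> a_rcosets\<^bsub>M\<^esub> W" "Y \<in> a_rcosets\<^bsub>M\<^esub> W"
    then show "a \<odot>\<^bsub>quotient_module M W\<^esub> (X <+>\<^bsub>M\<^esub> Y)
        = a \<odot>\<^bsub>quotient_module M W\<^esub> X <+>\<^bsub>M\<^esub> a \<odot>\<^bsub>quotient_module M W\<^esub> Y"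
      using ex[of X] ex[of Y] smult A.a_rcos_sum by (auto simp: M.smult_r_distr)
  next
    fix X assume "X \<in> a_rcosets\<^bsub>M\<^esub> W"
    then show "\<one>\<^bsub>K\<^esub> \<odot>\<^bsub>quotient_module M W\<^esub> X = X"
      using ex[of X] smult by auto
  qed
qed

lemma bilinear_relations_subset:
  assumes "module K M" "module K N"
  shows "bilinear_relations K M N \<subseteq> carrier (free_module K (carrier M \<times> carrier N))"
proof -
  interpret M: module K M by fact
  interpret N: module K N by fact
  interpret F: module K "free_module K (carrier M \<times> carrier N)"
    by (rule free_module_module) (rule M.R.is_cring)
  have "free_gen K (carrier M \<times> carrier N) (m, n) \<in> carrier (free_module K (carrier M \<times> carrier N))"
    if "m \<in> carrier M" "n \<in> carrier N" for m n
    using that by (intro free_gen_closed M.R.is_cring) auto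
  then show ?thesis
    unfolding bilinear_relations_def Let_def by (intro Un_least subsetI) auto
qed

lemma tensor_kernel_submodule:
  assumes "module K M" "module K N"
  shows "LinearCombinations.submodule K (tensor_kernel K M N)
    (free_module K (carrier M \<times> carrier N))"
proof -
  interpret M: module K M by fact
  interpret F: module K "free_module K (carrier M \<times> carrier N)"
    by (rule free_module_module) (rule M.R.is_cring)
  show ?thesis
    unfolding tensor_kernel_def
    by (rule F.span_is_submodule) (rule bilinear_relations_subset[OF assms])
qed

lemma tensor_module:
  assumes "module K M" "module K N"
  shows "module K (M \<Otimes>[K] N)"
  unfolding tensor_def by (rule quotient_module_module[OF tensor_kernel_submodule[OF assms]])

lemma tensor_vectorspace:
  assumes "vectorspace K M" "vectorspace K N"
  shows "vectorspace K (M \<Otimes>[K] N)"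
  using assms tensor_module by (auto simp: vectorspace_def)

definition free_lift where
  "free_lift K P I \<phi> p = (\<Oplus>\<^bsub>P\<^esub>i\<in>{i \<in> I. p i \<noteq> \<zero>\<^bsub>K\<^esub>}. p i \<odot>\<^bsub>P\<^esub> \<phi> i)"

lemma free_lift_superset:
  assumes "module K P" "\<phi> \<in> I \<rightarrow> carrier P" "p \<in> carrier (free_module K I)"
    "finite S" "S \<subseteq> I" "{i \<in> I. p i \<noteq> \<zero>\<^bsub>K\<^esub>} \<subseteq> S"
  shows "free_lift K P I \<phi> p = (\<Oplus>\<^bsub>P\<^esub>i\<in>S. p i \<odot>\<^bsub>P\<^esub> \<phi> i)"
proof -
  interpret P: module K P by fact
  have p: "p i \<in> carrier K" if "i \<in> I" for i
    using assms(3) that by (auto simp: free_module_simps[OF P.R.ring_axioms])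
  show ?thesis
    unfolding free_lift_def
  proof (rule P.add.finprod_mono_neutral_cong_left)
    fix i assume "i \<in> S - {i \<in> I. p i \<noteq> \<zero>\<^bsub>K\<^esub>}"
    then show "p i \<odot>\<^bsub>P\<^esub> \<phi> i = \<zero>\<^bsub>P\<^esub>"
      using assms(2,5) by (auto intro!: P.lmult_0)
  qed (use assms p in \<open>auto intro!: P.smult_closed simp: Pi_iff subset_iff\<close>)
qed

lemma free_lift_hom:
  assumes "module K P" "\<phi> \<in> I \<rightarrow> carrier P"
  shows "free_lift K P I \<phi> \<in> module_hom K (free_module K I) P"
proof -
  interpret P: module K P by fact
  interpret F: module K "free_module K I"
    by (rule free_module_module) (rule P.R.is_cring)
  note fs = free_module_simps[OF P.R.ring_axioms]
  have c: "p i \<in> carrier K" if "p \<in> carrier (free_module K I)" "i \<in> I" for p i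
    using that by (auto simp: fs)
  have fin: "finite {i \<in> I. p i \<noteq> \<zero>\<^bsub>K\<^esub>}" if "p \<in> carrier (free_module K I)" for p
    using that by (auto simp: fs)
  have \<phi>: "\<phi> i \<in> carrier P" if "i \<in> I" for i
    using assms that by auto
  note sup = free_lift_superset[OF assms]
  show ?thesis
    unfolding module_hom_def
  proof (intro CollectI conjI allI impI, goal_cases)
    case 1
    show ?case
      unfolding free_lift_def by (intro Pi_I P.finsum_closed) (auto intro!: c \<phi>)
  next
    case (2 p q)
    then have p: "p \<in> carrier (free_module K I)" and q: "q \<in> carrier (free_module K I)" by auto
    let ?S = "{i \<in> I. p i \<noteq> \<zero>\<^bsub>K\<^esub>} \<union> {i \<in> I. q i \<noteq> \<zero>\<^bsub>K\<^esub>}"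
    have S: "finite ?S" "?S \<subseteq> I" using fin p q by auto
    have "free_lift K P I \<phi> (p \<oplus>\<^bsub>free_module K I\<^esub> q)
      = (\<Oplus>\<^bsub>P\<^esub>i\<in>?S. (p \<oplus>\<^bsub>free_module K I\<^esub> q) i \<odot>\<^bsub>P\<^esub> \<phi> i)"
      using p q S by (intro sup F.M.add.m_closed[simplified]) (auto simp: fs)
    also have "\<dots> = (\<Oplus>\<^bsub>P\<^esub>i\<in>?S. p i \<odot>\<^bsub>P\<^esub> \<phi> i \<oplus>\<^bsub>P\<^esub> q i \<odot>\<^bsub>P\<^esub> \<phi> i)"
      using p q by (intro P.add.finprod_cong') (auto simp: fs(3) P.smult_l_distr c \<phi> intro!: P.smult_closed)
    also have "\<dots> = (\<Oplus>\<^bsub>P\<^esub>i\<in>?S. p i \<odot>\<^bsub>P\<^esub> \<phi> i) \<oplus>\<^bsub>P\<^esub> (\<Oplus>\<^bsub>P\<^esub>i\<in>?S. q i \<odot>\<^bsub>P\<^esub> \<phi> i)"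
      using p q by (intro P.finsum_addf) (auto intro!: c \<phi>)
    also have "\<dots> = free_lift K P I \<phi> p \<oplus>\<^bsub>P\<^esub> free_lift K P I \<phi> q"
      using p q S by (simp add: sup[of p ?S] sup[of q ?S])
    finally show ?case .
  next
    case (3 a p)
    then have p: "p \<in> carrier (free_module K I)" and a: "a \<in> carrier K" by auto
    let ?S = "{i \<in> I. p i \<noteq> \<zero>\<^bsub>K\<^esub>}"
    have "free_lift K P I \<phi> (a \<odot>\<^bsub>free_module K I\<^esub> p)
      = (\<Oplus>\<^bsub>P\<^esub>i\<in>?S. (a \<odot>\<^bsub>free_module K I\<^esub> p) i \<odot>\<^bsub>P\<^esub> \<phi> i)"
      using p a fin[OF p] by (intro sup F.smult_closed) (auto simp: fs)
    also have "\<dots> = (\<Oplus>\<^bsub>P\<^esub>i\<in>?S. a \<odot>\<^bsub>P\<^esub> (p i \<odot>\<^bsub>P\<^esub> \<phi> i))"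
      using p a by (intro P.add.finprod_cong') (auto simp: fs(4) P.smult_assoc1 c \<phi> intro!: P.smult_closed)
    also have "\<dots> = a \<odot>\<^bsub>P\<^esub> free_lift K P I \<phi> p"
      unfolding free_lift_def using p a fin[OF p]
      by (intro P.finsum_smult_ldistr[symmetric]) (auto intro!: c \<phi>)
    finally show ?case .
  qed
qed

lemma free_lift_gen:
  assumes "module K P" "\<phi> \<in> I \<rightarrow> carrier P" "j \<in> I"
  shows "free_lift K P I \<phi> (free_gen K I j) = \<phi> j"
proof -
  interpret P: module K P by fact
  have "free_lift K P I \<phi> (free_gen K I j) = (\<Oplus>\<^bsub>P\<^esub>i\<in>{j}. free_gen K I j i \<odot>\<^bsub>P\<^esub> \<phi> i)"
    using assms by (intro free_lift_superset free_gen_closed P.R.is_cring) (auto simp: free_gen_def)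
  also have "\<dots> = \<one>\<^bsub>K\<^esub> \<odot>\<^bsub>P\<^esub> \<phi> j"
    using assms by (subst P.finsum_insert) (auto simp: free_gen_def Pi_iff intro!: P.r_zero P.smult_closed)
  also have "\<dots> = \<phi> j"
    using assms by (intro P.smult_one) auto
  finally show ?thesis .
qed

lemma free_hom_eqI:
  fixes P :: "('a, 'd, 'e) module_scheme"
  assumes "module K P" "f \<in> module_hom K (free_module K I) P" "g \<in> module_hom K (free_module K I) P"
    and "\<And>j. j \<in> I \<Longrightarrow> f (free_gen K I j) = g (free_gen K I j)"
    and "p \<in> carrier (free_module K I)"
  shows "f p = g p"
proof -
  interpret P: module K P by fact
  note fs = free_module_simps[OF P.R.ring_axioms]
  interpret F: module K "free_module K I"
    by (rule free_module_module) (rule P.R.is_cring)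
  interpret f: mod_hom K "free_module K I" P f by unfold_locales (rule assms)
  interpret g: mod_hom K "free_module K I" P g by unfold_locales (rule assms)
  have "f p = g p" if "finite S" "{i \<in> I. p i \<noteq> \<zero>\<^bsub>K\<^esub>} \<subseteq> S" "p \<in> carrier (free_module K I)" for S p
    using that
  proof (induction S arbitrary: p)
    case empty
    then have "p = \<zero>\<^bsub>free_module K I\<^esub>"
      by (fastforce simp: fs PiE_iff extensional_def)
    then show ?case by simp
  next
    case (insert j S)
    show ?case
    proof (cases "j \<in> I")
      case False
      then show ?thesis using insert by (intro insert.IH) auto
    next
      case True
      define q where "q = p(j := \<zero>\<^bsub>K\<^esub>)"
      have "{i \<in> I. q i \<noteq> \<zero>\<^bsub>K\<^esub>} \<subseteq> S" using insert.prems by (auto simp: q_def)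
      moreover from this have "finite {i \<in> I. q i \<noteq> \<zero>\<^bsub>K\<^esub>}" using insert.hyps finite_subset by blast
      ultimately have q: "{i \<in> I. q i \<noteq> \<zero>\<^bsub>K\<^esub>} \<subseteq> S" "q \<in> carrier (free_module K I)"
        using insert.prems True
        by (auto simp: fs PiE_iff extensional_def) (auto simp: q_def)
      have pj: "p j \<in> carrier K" using insert.prems True by (auto simp: fs)
      have gen: "free_gen K I j \<in> carrier (free_module K I)"
        using True by (intro free_gen_closed P.R.is_cring)
      have "p = q \<oplus>\<^bsub>free_module K I\<^esub> p j \<odot>\<^bsub>free_module K I\<^esub> free_gen K I j"
        using insert.prems True
        by (auto simp: fs q_def free_gen_def fun_eq_iff PiE_iff extensional_def)
      then have "h p = h (q \<oplus>\<^bsub>free_module K I\<^esub> p j \<odot>\<^bsub>free_module K I\<^esub> free_gen K I j)" for h :: "_ \<Rightarrow> 'd"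
        by (rule arg_cong)
      moreover have "h (q \<oplus>\<^bsub>free_module K I\<^esub> p j \<odot>\<^bsub>free_module K I\<^esub> free_gen K I j)
          = h q \<oplus>\<^bsub>P\<^esub> p j \<odot>\<^bsub>P\<^esub> h (free_gen K I j)"
        if "h \<in> module_hom K (free_module K I) P" for h
        using that q gen pj F.smult_closed[OF pj gen] by (simp add: module_hom_def)
      ultimately have "h p = h q \<oplus>\<^bsub>P\<^esub> p j \<odot>\<^bsub>P\<^esub> h (free_gen K I j)"
        if "h \<in> module_hom K (free_module K I) P" for h
        using that by metis
      from this[OF assms(2)] this[OF assms(3)] show ?thesis
        using insert.IH[OF q] assms(4)[OF True] by simp
    qed
  qed
  from this[of "{i \<in> I. p i \<noteq> \<zero>\<^bsub>K\<^esub>}" p] show ?thesis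
    using assms(5) by (auto simp: fs)
qed

lemma coset_hom:
  assumes "module K M" "module K N"
  shows "(\<lambda>p. tensor_kernel K M N +>\<^bsub>free_module K (carrier M \<times> carrier N)\<^esub> p)
    \<in> module_hom K (free_module K (carrier M \<times> carrier N)) (M \<Otimes>[K] N)"
proof -
  note sub = tensor_kernel_submodule[OF assms]
  interpret W: LinearCombinations.submodule K "tensor_kernel K M N"
    "free_module K (carrier M \<times> carrier N)" by (rule sub)
  interpret F: module K "free_module K (carrier M \<times> carrier N)" by (rule W.module)
  interpret A: abelian_subgroup "tensor_kernel K M N" "free_module K (carrier M \<times> carrier N)"
    by (rule submodule_abelian_subgroup) (rule sub)
  show ?thesis
    unfolding module_hom_def tensor_def
    using quotient_smult[OF sub] A.a_rcos_sum F.a_rcosetsI[OF W.subset]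
    by (auto simp: quotient_simps)
qed

lemma tensor_carrier:
  "carrier (M \<Otimes>[K] N) =
    (\<lambda>p. tensor_kernel K M N +>\<^bsub>free_module K (carrier M \<times> carrier N)\<^esub> p) `
      carrier (free_module K (carrier M \<times> carrier N))"
  by (auto simp: tensor_def quotient_simps A_RCOSETS_def RCOSETS_def a_r_coset_def)

theorem pure_tensor_bilinear:
  assumes "module K M" "module K N"
  shows "bilinear_map K M N (M \<Otimes>[K] N) (pure_tensor K M N)"
proof -
  let ?I = "carrier M \<times> carrier N"
  let ?F = "free_module K ?I"
  let ?W = "tensor_kernel K M N"
  let ?q = "\<lambda>p. ?W +>\<^bsub>?F\<^esub> p"
  let ?d = "\<lambda>m n. free_gen K ?I (m, n)"
  interpret M: module K M by fact
  interpret N: module K N by fact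
  note sub = tensor_kernel_submodule[OF assms(1,2)]
  interpret W: LinearCombinations.submodule K ?W ?F by (rule sub)
  interpret F: module K ?F by (rule W.module)
  interpret A: abelian_subgroup ?W ?F by (rule submodule_abelian_subgroup) (rule sub)
  interpret T: module K "M \<Otimes>[K] N" by (rule tensor_module[OF assms])
  interpret q: mod_hom K ?F "M \<Otimes>[K] N" ?q
    by unfold_locales (rule coset_hom[OF assms])
  have gen: "?d m n \<in> carrier ?F" if "m \<in> carrier M" "n \<in> carrier N" for m n
    using that by (intro free_gen_closed M.R.is_cring) auto
  have eq: "?q x = ?q y" if "x \<ominus>\<^bsub>?F\<^esub> y \<in> bilinear_relations K M N"
    "x \<in> carrier ?F" "y \<in> carrier ?F" for x y
  proof -
    have "x \<ominus>\<^bsub>?F\<^esub> y \<in> ?W"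
      using that(1) F.in_own_span[OF bilinear_relations_subset[OF assms]]
      by (auto simp: tensor_kernel_def)
    moreover have "x = (x \<ominus>\<^bsub>?F\<^esub> y) \<oplus>\<^bsub>?F\<^esub> y"
      using that by (simp add: a_minus_def F.M.a_assoc F.M.l_neg)
    ultimately have "x \<in> ?q y"
      by (auto simp: a_r_coset_def r_coset_def)
    then show ?thesis
      using F.a_repr_independence[OF _ _ A.a_subgroup] that(3) by metis
  qed
  have 1: "?d (m \<oplus>\<^bsub>M\<^esub> m') n \<ominus>\<^bsub>?F\<^esub> (?d m n \<oplus>\<^bsub>?F\<^esub> ?d m' n) \<in> bilinear_relations K M N"
    if "m \<in> carrier M" "m' \<in> carrier M" "n \<in> carrier N" for m m' n
    using that unfolding bilinear_relations_def Let_def by blast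
  have 2: "?d m (n \<oplus>\<^bsub>N\<^esub> n') \<ominus>\<^bsub>?F\<^esub> (?d m n \<oplus>\<^bsub>?F\<^esub> ?d m n') \<in> bilinear_relations K M N"
    if "m \<in> carrier M" "n \<in> carrier N" "n' \<in> carrier N" for m n n'
    using that unfolding bilinear_relations_def Let_def by blast
  have 3: "?d (a \<odot>\<^bsub>M\<^esub> m) n \<ominus>\<^bsub>?F\<^esub> (a \<odot>\<^bsub>?F\<^esub> ?d m n) \<in> bilinear_relations K M N"
    if "a \<in> carrier K" "m \<in> carrier M" "n \<in> carrier N" for a m n
    using that unfolding bilinear_relations_def Let_def by blast
  have 4: "?d m (a \<odot>\<^bsub>N\<^esub> n) \<ominus>\<^bsub>?F\<^esub> (a \<odot>\<^bsub>?F\<^esub> ?d m n) \<in> bilinear_relations K M N"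
    if "a \<in> carrier K" "m \<in> carrier M" "n \<in> carrier N" for a m n
    using that unfolding bilinear_relations_def Let_def by blast
  have qc: "?q x \<in> carrier (M \<Otimes>[K] N)" if "x \<in> carrier ?F" for x
    using that by (simp add: tensor_carrier)
  show ?thesis
    unfolding bilinear_map_def module_hom_def pure_tensor_def
    by (auto simp: gen qc eq[OF 1] eq[OF 2] eq[OF 3] eq[OF 4])
qed

lemma module_hom_comp:
  assumes "f \<in> module_hom K L M" "g \<in> module_hom K M N"
  shows "g \<circ> f \<in> module_hom K L N"
  using assms by (auto simp: module_hom_def Pi_iff)

theorem tensor_hom_eqI:
  assumes "module K M" "module K N" "module K P"
    and "f \<in> module_hom K (M \<Otimes>[K] N) P" "g \<in> module_hom K (M \<Otimes>[K] N) P"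
    and "\<And>m n. m \<in> carrier M \<Longrightarrow> n \<in> carrier N \<Longrightarrow>
      f (pure_tensor K M N m n) = g (pure_tensor K M N m n)"
    and "x \<in> carrier (M \<Otimes>[K] N)"
  shows "f x = g x"
proof -
  let ?F = "free_module K (carrier M \<times> carrier N)"
  let ?q = "\<lambda>p. tensor_kernel K M N +>\<^bsub>?F\<^esub> p"
  note q = coset_hom[OF assms(1,2)]
  note comp = module_hom_comp[OF q]
  obtain p where p: "p \<in> carrier ?F" "x = ?q p"
    using assms(7) unfolding tensor_carrier by (elim imageE)
  have "(f \<circ> ?q) p = (g \<circ> ?q) p"
    by (rule free_hom_eqI[OF assms(3) comp[OF assms(4)] comp[OF assms(5)] _ p(1)])
      (auto simp: assms(6) simp flip: pure_tensor_def)
  then show ?thesis using p by simp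
qed

theorem
  assumes "module K M" "module K N" "module K P" "bilinear_map K M N P \<beta>"
  shows tensor_lift_hom: "tensor_lift K M N P \<beta> \<in> module_hom K (M \<Otimes>[K] N) P"
    and tensor_lift_pure: "\<And>m n. m \<in> carrier M \<Longrightarrow> n \<in> carrier N \<Longrightarrow>
      tensor_lift K M N P \<beta> (pure_tensor K M N m n) = \<beta> m n"
proof -
  let ?I = "carrier M \<times> carrier N"
  let ?F = "free_module K ?I"
  let ?W = "tensor_kernel K M N"
  let ?q = "\<lambda>p. ?W +>\<^bsub>?F\<^esub> p"
  let ?\<phi> = "\<lambda>i. \<beta> (fst i) (snd i)"
  let ?L = "free_lift K P ?I ?\<phi>"
  interpret M: module K M by fact
  interpret N: module K N by fact
  interpret P: module K P by fact
  have \<phi>: "?\<phi> \<in> ?I \<rightarrow> carrier P"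
    using assms(4) by (auto simp: bilinear_map_def module_hom_def Pi_iff)
  note sub = tensor_kernel_submodule[OF assms(1,2)]
  interpret W: LinearCombinations.submodule K ?W ?F by (rule sub)
  interpret F: module K ?F by (rule W.module)
  interpret A: abelian_subgroup ?W ?F by (rule submodule_abelian_subgroup) (rule sub)
  interpret L: mod_hom K ?F P ?L by unfold_locales (rule free_lift_hom[OF assms(3) \<phi>])
  have gen: "free_gen K ?I i \<in> carrier ?F" if "i \<in> ?I" for i
    using that by (intro free_gen_closed M.R.is_cring)
  have Lg: "?L (free_gen K ?I i) = ?\<phi> i" if "i \<in> ?I" for i
    using that by (intro free_lift_gen \<phi> assms)
  have diff: "x \<ominus>\<^bsub>?F\<^esub> y \<in> L.ker" if "x \<in> carrier ?F" "y \<in> carrier ?F" "?L x = ?L y" for x y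
  proof -
    have "?L (x \<ominus>\<^bsub>?F\<^esub> y) \<oplus>\<^bsub>P\<^esub> ?L y = ?L x"
      using that by (simp flip: L.f_add add: a_minus_def F.M.a_assoc F.M.l_neg)
    then have "?L (x \<ominus>\<^bsub>?F\<^esub> y) = \<zero>\<^bsub>P\<^esub>"
      using that by simp
    then show ?thesis using that by (simp add: L.ker_def)
  qed
  have \<beta>:
    "\<beta> m n \<in> carrier P" "\<beta> (m \<oplus>\<^bsub>M\<^esub> m') n = \<beta> m n \<oplus>\<^bsub>P\<^esub> \<beta> m' n" "\<beta> m (n \<oplus>\<^bsub>N\<^esub> n') = \<beta> m n \<oplus>\<^bsub>P\<^esub> \<beta> m n'"
    "a \<in> carrier K \<Longrightarrow> \<beta> (a \<odot>\<^bsub>M\<^esub> m) n = a \<odot>\<^bsub>P\<^esub> \<beta> m n" "a \<in> carrier K \<Longrightarrow> \<beta> m (a \<odot>\<^bsub>N\<^esub> n) = a \<odot>\<^bsub>P\<^esub> \<beta> m n"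
    if "m \<in> carrier M" "m' \<in> carrier M" "n \<in> carrier N" "n' \<in> carrier N" for a m m' n n'
    using assms(4) that unfolding bilinear_map_def module_hom_def by auto
  have "bilinear_relations K M N \<subseteq> L.ker"
    unfolding bilinear_relations_def Let_def
    by (intro Un_least subsetI) (auto intro!: diff gen F.smult_closed F.M.a_closed simp: gen Lg \<beta>)
  then have "?W \<subseteq> L.ker"
    unfolding tensor_kernel_def by (rule F.span_is_subset) (rule L.ker_is_submodule)
  then have W: "?L w = \<zero>\<^bsub>P\<^esub>" if "w \<in> ?W" for w
    using that by (auto simp: L.ker_def)
  have lift: "tensor_lift K M N P \<beta> (?q p) = ?L p" if p: "p \<in> carrier ?F" for p
  proof -
    have "(SOME r. r \<in> ?q p) \<in> ?q p"
      using A.a_rcos_self[OF p] by (rule someI[where P = "\<lambda>r. r \<in> ?q p"])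
    then obtain w where w: "w \<in> ?W" "(SOME r. r \<in> ?q p) = w \<oplus>\<^bsub>?F\<^esub> p"
      by (auto simp: a_r_coset_def r_coset_def)
    have "tensor_lift K M N P \<beta> (?q p) = ?L (w \<oplus>\<^bsub>?F\<^esub> p)"
      unfolding tensor_lift_def free_lift_def w(2) Let_def ..
    also have "\<dots> = ?L p"
      using w(1) p W.subset by (auto simp: W subset_iff)
    finally show ?thesis .
  qed
  show "tensor_lift K M N P \<beta> (pure_tensor K M N m n) = \<beta> m n"
    if "m \<in> carrier M" "n \<in> carrier N" for m n
    using that by (simp add: pure_tensor_def lift gen Lg)
  have ex: "\<exists>p\<in>carrier ?F. X = ?q p" if "X \<in> carrier (M \<Otimes>[K] N)" for X
    using that unfolding tensor_carrier by (elim imageE) (intro bexI)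
  have q: "mod_hom K ?F (M \<Otimes>[K] N) ?q"
    using coset_hom[OF assms(1,2)] tensor_module[OF assms(1,2)] F.module_axioms
    by (intro mod_hom.intro mod_hom_axioms.intro)
  interpret q: mod_hom K ?F "M \<Otimes>[K] N" ?q by (rule q)
  show "tensor_lift K M N P \<beta> \<in> module_hom K (M \<Otimes>[K] N) P"
    unfolding module_hom_def
  proof (intro CollectI conjI allI impI Pi_I)
    fix X assume "X \<in> carrier (M \<Otimes>[K] N)"
    then show "tensor_lift K M N P \<beta> X \<in> carrier P"
      using ex[of X] lift by auto
  next
    fix X Y assume "X \<in> carrier (M \<Otimes>[K] N) \<and> Y \<in> carrier (M \<Otimes>[K] N)"
    then obtain x y where "x \<in> carrier ?F" "X = ?q x" "y \<in> carrier ?F" "Y = ?q y"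
      using ex by meson
    then show "tensor_lift K M N P \<beta> (X \<oplus>\<^bsub>M \<Otimes>[K] N\<^esub> Y)
        = tensor_lift K M N P \<beta> X \<oplus>\<^bsub>P\<^esub> tensor_lift K M N P \<beta> Y"
      by (simp flip: q.f_add add: lift)
  next
    fix a X assume "a \<in> carrier K \<and> X \<in> carrier (M \<Otimes>[K] N)"
    then obtain x where "a \<in> carrier K" "x \<in> carrier ?F" "X = ?q x"
      using ex by meson
    then show "tensor_lift K M N P \<beta> (a \<odot>\<^bsub>M \<Otimes>[K] N\<^esub> X) = a \<odot>\<^bsub>P\<^esub> tensor_lift K M N P \<beta> X"
      by (simp flip: q.f_smult add: lift)
  qed
qed

lemma bilinear_map_comp:
  assumes "bilinear_map K P Q R \<beta>" "f \<in> module_hom K M P" "g \<in> module_hom K N Q"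
  shows "bilinear_map K M N R (\<lambda>m n. \<beta> (f m) (g n))"
  using assms by (simp add: bilinear_map_def module_hom_def Pi_iff)

lemma module_hom_id: "id \<in> module_hom K M M"
  by (simp add: module_hom_def)

lemma pure_tensor_hom:
  assumes "module K M" "module K N"
  shows "m \<in> carrier M \<Longrightarrow> pure_tensor K M N m \<in> module_hom K N (M \<Otimes>[K] N)"
    and "n \<in> carrier N \<Longrightarrow> (\<lambda>m. pure_tensor K M N m n) \<in> module_hom K M (M \<Otimes>[K] N)"
    and "m \<in> carrier M \<Longrightarrow> n \<in> carrier N \<Longrightarrow> pure_tensor K M N m n \<in> carrier (M \<Otimes>[K] N)"
  using pure_tensor_bilinear[OF assms] by (simp_all add: bilinear_map_def module_hom_def Pi_iff)

theorem
  assumes "module K M" "module K N" "module K P" "module K Q"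
    and "f \<in> module_hom K M P" "g \<in> module_hom K N Q"
  shows tensor_map_hom: "tensor_map K M N P Q f g \<in> module_hom K (M \<Otimes>[K] N) (P \<Otimes>[K] Q)"
    and tensor_map_pure: "\<And>m n. m \<in> carrier M \<Longrightarrow> n \<in> carrier N \<Longrightarrow>
      tensor_map K M N P Q f g (pure_tensor K M N m n) = pure_tensor K P Q (f m) (g n)"
proof -
  have b: "bilinear_map K M N (P \<Otimes>[K] Q) (\<lambda>m n. pure_tensor K P Q (f m) (g n))"
    by (rule bilinear_map_comp[OF pure_tensor_bilinear]) (use assms in auto)
  note T = tensor_module[OF assms(3,4)]
  show "tensor_map K M N P Q f g \<in> module_hom K (M \<Otimes>[K] N) (P \<Otimes>[K] Q)"
    unfolding tensor_map_def by (rule tensor_lift_hom[OF assms(1,2) T b])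
  show "tensor_map K M N P Q f g (pure_tensor K M N m n) = pure_tensor K P Q (f m) (g n)"
    if "m \<in> carrier M" "n \<in> carrier N" for m n
    unfolding tensor_map_def by (rule tensor_lift_pure[OF assms(1,2) T b that])
qed

lemma module_hom_add_fun:
  assumes "module K P" "f \<in> module_hom K M P" "g \<in> module_hom K M P"
  shows "(\<lambda>x. f x \<oplus>\<^bsub>P\<^esub> g x) \<in> module_hom K M P"
proof -
  interpret P: module K P by fact
  show ?thesis
    using assms(2,3) by (auto simp: module_hom_def Pi_iff P.smult_r_distr P.M.add.m_ac)
qed

lemma module_hom_smult_fun:
  assumes "module K P" "f \<in> module_hom K M P" "a \<in> carrier K"
  shows "(\<lambda>x. a \<odot>\<^bsub>P\<^esub> f x) \<in> module_hom K M P"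
proof -
  interpret P: module K P by fact
  show ?thesis
    using assms(2,3)
    by (auto simp: module_hom_def Pi_iff P.smult_r_distr P.R.m_comm simp flip: P.smult_assoc1)
qed

(* Currying: a family of bilinear maps depending linearly on a parameter. *)
lemma trilinear_lift:
  assumes "module K L" "module K M" "module K N" "module K P"
    and b: "\<And>n. n \<in> carrier N \<Longrightarrow> bilinear_map K L M P (\<lambda>l m. \<tau> l m n)"
    and h: "\<And>l m. l \<in> carrier L \<Longrightarrow> m \<in> carrier M \<Longrightarrow> \<tau> l m \<in> module_hom K N P"
  shows "bilinear_map K (L \<Otimes>[K] M) N P (\<lambda>x n. tensor_lift K L M P (\<lambda>l m. \<tau> l m n) x)"
proof -
  interpret N: module K N by fact
  let ?h = "\<lambda>n. tensor_lift K L M P (\<lambda>l m. \<tau> l m n)"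
  note hom = tensor_lift_hom[OF assms(1,2,4) b]
  note pure = tensor_lift_pure[OF assms(1,2,4) b]
  note eqI = tensor_hom_eqI[OF assms(1,2,4)]
  have add: "?h (n \<oplus>\<^bsub>N\<^esub> n') x = ?h n x \<oplus>\<^bsub>P\<^esub> ?h n' x"
    if n: "n \<in> carrier N" "n' \<in> carrier N" and x: "x \<in> carrier (L \<Otimes>[K] M)" for n n' x
  proof (rule eqI[OF hom module_hom_add_fun[OF assms(4) hom hom] _ x])
    fix l m assume lm: "l \<in> carrier L" "m \<in> carrier M"
    show "?h (n \<oplus>\<^bsub>N\<^esub> n') (pure_tensor K L M l m)
        = ?h n (pure_tensor K L M l m) \<oplus>\<^bsub>P\<^esub> ?h n' (pure_tensor K L M l m)"
      using n lm h[OF lm] by (simp add: pure module_hom_def)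
  qed (use n in auto)
  have smult: "?h (a \<odot>\<^bsub>N\<^esub> n) x = a \<odot>\<^bsub>P\<^esub> ?h n x"
    if n: "a \<in> carrier K" "n \<in> carrier N" and x: "x \<in> carrier (L \<Otimes>[K] M)" for a n x
  proof (rule eqI[OF hom module_hom_smult_fun[OF assms(4) hom] _ x])
    fix l m assume lm: "l \<in> carrier L" "m \<in> carrier M"
    show "?h (a \<odot>\<^bsub>N\<^esub> n) (pure_tensor K L M l m) = a \<odot>\<^bsub>P\<^esub> ?h n (pure_tensor K L M l m)"
      using n lm h[OF lm] by (simp add: pure module_hom_def)
  qed (use n in auto)
  have closed: "?h n x \<in> carrier P" if "n \<in> carrier N" "x \<in> carrier (L \<Otimes>[K] M)" for n x
    using hom[OF that(1)] that(2) by (auto simp: module_hom_def)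
  show ?thesis
    unfolding bilinear_map_def using hom
    by (auto simp: module_hom_def add smult closed)
qed

lemma bilinear_map_flip:
  "bilinear_map K M N P \<beta> \<longleftrightarrow> bilinear_map K N M P (\<lambda>n m. \<beta> m n)"
  by (auto simp: bilinear_map_def)

theorem
  assumes "module K L" "module K M" "module K N"
  shows associator_hom: "associator K L M N \<in>
      module_hom K ((L \<Otimes>[K] M) \<Otimes>[K] N) (L \<Otimes>[K] (M \<Otimes>[K] N))"
    and associator_pure: "\<And>l m n. l \<in> carrier L \<Longrightarrow> m \<in> carrier M \<Longrightarrow> n \<in> carrier N \<Longrightarrow>
      associator K L M N (pure_tensor K (L \<Otimes>[K] M) N (pure_tensor K L M l m) n) =
      pure_tensor K L (M \<Otimes>[K] N) l (pure_tensor K M N m n)"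
proof -
  note MN = tensor_module[OF assms(2,3)] and LM = tensor_module[OF assms(1,2)]
  note T = tensor_module[OF assms(1) MN]
  let ?\<tau> = "\<lambda>l m n. pure_tensor K L (M \<Otimes>[K] N) l (pure_tensor K M N m n)"
  have b: "bilinear_map K L M (L \<Otimes>[K] (M \<Otimes>[K] N)) (\<lambda>l m. ?\<tau> l m n)" if "n \<in> carrier N" for n
    using bilinear_map_comp[OF pure_tensor_bilinear[OF assms(1) MN] module_hom_id
        pure_tensor_hom(2)[OF assms(2,3) that]] by simp
  have h: "?\<tau> l m \<in> module_hom K N (L \<Otimes>[K] (M \<Otimes>[K] N))"
    if "l \<in> carrier L" "m \<in> carrier M" for l m
    using module_hom_comp[OF pure_tensor_hom(1)[OF assms(2,3) that(2)]
        pure_tensor_hom(1)[OF assms(1) MN that(1)]] by (simp add: comp_def)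
  note tri = trilinear_lift[OF assms T b h]
  show "associator K L M N \<in> module_hom K ((L \<Otimes>[K] M) \<Otimes>[K] N) (L \<Otimes>[K] (M \<Otimes>[K] N))"
    unfolding associator_def by (rule tensor_lift_hom[OF LM assms(3) T tri])
  show "associator K L M N (pure_tensor K (L \<Otimes>[K] M) N (pure_tensor K L M l m) n) = ?\<tau> l m n"
    if "l \<in> carrier L" "m \<in> carrier M" "n \<in> carrier N" for l m n
    unfolding associator_def using that
    by (simp add: tensor_lift_pure[OF LM assms(3) T tri] pure_tensor_hom(3)[OF assms(1,2)]
        tensor_lift_pure[OF assms(1,2) T b])
qed

theorem
  assumes "module K L" "module K M" "module K N"
  shows associator_inv_hom: "associator_inv K L M N \<in>
      module_hom K (L \<Otimes>[K] (M \<Otimes>[K] N)) ((L \<Otimes>[K] M) \<Otimes>[K] N)"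
    and associator_inv_pure: "\<And>l m n. l \<in> carrier L \<Longrightarrow> m \<in> carrier M \<Longrightarrow> n \<in> carrier N \<Longrightarrow>
      associator_inv K L M N (pure_tensor K L (M \<Otimes>[K] N) l (pure_tensor K M N m n)) =
      pure_tensor K (L \<Otimes>[K] M) N (pure_tensor K L M l m) n"
proof -
  note MN = tensor_module[OF assms(2,3)] and LM = tensor_module[OF assms(1,2)]
  note T = tensor_module[OF LM assms(3)]
  let ?\<tau> = "\<lambda>m n l. pure_tensor K (L \<Otimes>[K] M) N (pure_tensor K L M l m) n"
  have b: "bilinear_map K M N ((L \<Otimes>[K] M) \<Otimes>[K] N) (\<lambda>m n. ?\<tau> m n l)" if "l \<in> carrier L" for l
    using bilinear_map_comp[OF pure_tensor_bilinear[OF LM assms(3)]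
        pure_tensor_hom(1)[OF assms(1,2) that] module_hom_id] by simp
  have h: "?\<tau> m n \<in> module_hom K L ((L \<Otimes>[K] M) \<Otimes>[K] N)"
    if "m \<in> carrier M" "n \<in> carrier N" for m n
    using module_hom_comp[OF pure_tensor_hom(2)[OF assms(1,2) that(1)]
        pure_tensor_hom(2)[OF LM assms(3) that(2)]] by (simp add: comp_def)
  have tri: "bilinear_map K L (M \<Otimes>[K] N) ((L \<Otimes>[K] M) \<Otimes>[K] N)
      (\<lambda>l y. tensor_lift K M N ((L \<Otimes>[K] M) \<Otimes>[K] N) (\<lambda>m n. ?\<tau> m n l) y)"
    by (subst bilinear_map_flip) (rule trilinear_lift[OF assms(2,3,1) T b h])
  show "associator_inv K L M N \<in> module_hom K (L \<Otimes>[K] (M \<Otimes>[K] N)) ((L \<Otimes>[K] M) \<Otimes>[K] N)"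
    unfolding associator_inv_def by (rule tensor_lift_hom[OF assms(1) MN T tri])
  show "associator_inv K L M N (pure_tensor K L (M \<Otimes>[K] N) l (pure_tensor K M N m n)) = ?\<tau> m n l"
    if "l \<in> carrier L" "m \<in> carrier M" "n \<in> carrier N" for l m n
    unfolding associator_inv_def using that
    by (simp add: tensor_lift_pure[OF assms(1) MN T tri] pure_tensor_hom(3)[OF assms(2,3)]
        tensor_lift_pure[OF assms(2,3) T b])
qed

end

theory Submission
  imports Defs
begin

text \<open>
  Write \<open>\<Psi>\<close> for \<open>\<Psi>'\<close> and regard both sides of the coassociativity condition as functions of the
  twist map. Replacing \<open>\<chi>\<close> by \<open>\<Psi>\<chi>\<close> multiplies either side from the left by the same map
  \<open>\<Psi> \<otimes> \<Psi>\<close> on \<open>D \<otimes> C \<otimes> D \<otimes> C\<close>, so an equality for \<open>\<chi>\<close> becomes an equality for \<open>\<Psi>\<chi>\<close>.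

  On the left-hand side two copies of \<open>\<Psi>\<close> appear. The outer one is already on the last two
  factors. The inner one, \<open>\<Psi> \<otimes> id\<^sub>D\<close>, must pass \<open>id\<^sub>D \<otimes> \<Delta>\<^sub>C \<otimes> id\<^sub>D\<close>, which it does because
  \<open>\<Psi>\<close> commutes with the right \<open>C\<close>-coaction \<open>id\<^sub>D \<otimes> \<Delta>\<^sub>C\<close> (\<open>front_map_coaction\<close>). It then acts
  on the first two factors and so commutes with \<open>\<chi>\<close> acting on the last two
  (\<open>front_map_interchange\<close>). On the right-hand side the outer copy of \<open>\<Psi>\<close> is already on the first
  two factors, and the inner one passes \<open>\<Delta>\<^sub>D\<close> because \<open>\<Psi>\<close> commutes with the left
  \<open>D\<close>-coaction; it ends on the last two factors and again commutes with \<open>\<chi>\<close> on the first two.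

  What remains is the movement of brackets. A map \<open>f\<close> on the first two factors of a product
  bracketed to the right is \<open>f \<otimes> id\<close> conjugated by associators, called \<open>front_map\<close> below. That such
  maps do not depend on how the rest of the product is bracketed is a consequence of naturality of the
  associator and of the pentagon identity, and these are checked on pure tensors.
\<close>

section \<open>Linear maps on tensor products\<close>

lemma module_hom_closed:
  "f \<in> module_hom K M N \<Longrightarrow> x \<in> carrier M \<Longrightarrow> f x \<in> carrier N"
  by (auto simp: module_hom_def)

text \<open>Fixing the last factor turns a linear map on a triple product into a linear map on a double
  product, so agreement on pure tensors propagates one factor at a time.\<close>

lemma tensor_hom_eqI_left:
  assumes "module K L" "module K M" "module K N" "module K P"
    and "f \<in> module_hom K ((L \<Otimes>[K] M) \<Otimes>[K] N) P" "g \<in> module_hom K ((L \<Otimes>[K] M) \<Otimes>[K] N) P"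
    and eq: "\<And>l m n. l \<in> carrier L \<Longrightarrow> m \<in> carrier M \<Longrightarrow> n \<in> carrier N \<Longrightarrow>
      f (pure_tensor K (L \<Otimes>[K] M) N (pure_tensor K L M l m) n) =
      g (pure_tensor K (L \<Otimes>[K] M) N (pure_tensor K L M l m) n)"
    and "x \<in> carrier ((L \<Otimes>[K] M) \<Otimes>[K] N)"
  shows "f x = g x"
proof (rule tensor_hom_eqI[OF tensor_module[OF assms(1,2)] assms(3,4,5,6) _ assms(8)])
  fix t n assume t: "t \<in> carrier (L \<Otimes>[K] M)" and n: "n \<in> carrier N"
  note h = module_hom_comp[OF pure_tensor_hom(2)[OF tensor_module[OF assms(1,2)] assms(3) n]]
  show "f (pure_tensor K (L \<Otimes>[K] M) N t n) = g (pure_tensor K (L \<Otimes>[K] M) N t n)"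
    using tensor_hom_eqI[OF assms(1,2,4) h[OF assms(5)] h[OF assms(6)] _ t] n
    by (simp add: eq)
qed

lemma tensor_hom_eqI_right:
  assumes "module K L" "module K M" "module K N" "module K P"
    and "f \<in> module_hom K (L \<Otimes>[K] (M \<Otimes>[K] N)) P" "g \<in> module_hom K (L \<Otimes>[K] (M \<Otimes>[K] N)) P"
    and eq: "\<And>l m n. l \<in> carrier L \<Longrightarrow> m \<in> carrier M \<Longrightarrow> n \<in> carrier N \<Longrightarrow>
      f (pure_tensor K L (M \<Otimes>[K] N) l (pure_tensor K M N m n)) =
      g (pure_tensor K L (M \<Otimes>[K] N) l (pure_tensor K M N m n))"
    and "x \<in> carrier (L \<Otimes>[K] (M \<Otimes>[K] N))"
  shows "f x = g x"
proof (rule tensor_hom_eqI[OF assms(1) tensor_module[OF assms(2,3)] assms(4,5,6) _ assms(8)])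
  fix l t assume l: "l \<in> carrier L" and t: "t \<in> carrier (M \<Otimes>[K] N)"
  note h = module_hom_comp[OF pure_tensor_hom(1)[OF assms(1) tensor_module[OF assms(2,3)] l]]
  show "f (pure_tensor K L (M \<Otimes>[K] N) l t) = g (pure_tensor K L (M \<Otimes>[K] N) l t)"
    using tensor_hom_eqI[OF assms(2,3,4) h[OF assms(5)] h[OF assms(6)] _ t] l
    by (simp add: eq)
qed

lemma tensor_map_comp:
  assumes "module K L" "module K L'" "module K M" "module K M'" "module K N" "module K N'"
    and f: "f \<in> module_hom K L M" and f': "f' \<in> module_hom K L' M'"
    and g: "g \<in> module_hom K M N" and g': "g' \<in> module_hom K M' N'"
    and x: "x \<in> carrier (L \<Otimes>[K] L')"
  shows "tensor_map K M M' N N' g g' (tensor_map K L L' M M' f f' x) =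
    tensor_map K L L' N N' (g \<circ> f) (g' \<circ> f') x"
proof -
  note [simp] = assms(1-6)
  note gf = module_hom_comp[OF f g] module_hom_comp[OF f' g']
  have l: "tensor_map K M M' N N' g g' \<circ> tensor_map K L L' M M' f f' \<in> module_hom K (L \<Otimes>[K] L') (N \<Otimes>[K] N')"
    by (intro module_hom_comp[OF tensor_map_hom tensor_map_hom] f f' g g' assms)
  have r: "tensor_map K L L' N N' (g \<circ> f) (g' \<circ> f') \<in> module_hom K (L \<Otimes>[K] L') (N \<Otimes>[K] N')"
    by (intro tensor_map_hom gf assms)
  have "(tensor_map K M M' N N' g g' \<circ> tensor_map K L L' M M' f f') x =
      tensor_map K L L' N N' (g \<circ> f) (g' \<circ> f') x"
    by (rule tensor_hom_eqI[of K L L' "N \<Otimes>[K] N'", OF _ _ _ l r])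
      (simp_all add: tensor_module x f f' g g' gf tensor_map_pure module_hom_closed[OF f] module_hom_closed[OF f'])
  then show ?thesis by simp
qed

text \<open>Linear maps are not required to be extensional, so maps that agree on the carriers can differ
  as functions; this rule lets an identity between such maps be used inside a tensor product.\<close>

lemma tensor_map_cong:
  assumes "module K M" "module K N" "module K P" "module K Q"
    and "f \<in> module_hom K M P" "f' \<in> module_hom K M P"
    and "g \<in> module_hom K N Q" "g' \<in> module_hom K N Q"
    and "\<And>m. m \<in> carrier M \<Longrightarrow> f m = f' m" "\<And>n. n \<in> carrier N \<Longrightarrow> g n = g' n"
    and "x \<in> carrier (M \<Otimes>[K] N)"
  shows "tensor_map K M N P Q f g x = tensor_map K M N P Q f' g' x"
  by (rule tensor_hom_eqI[OF assms(1,2) _ _ _ _ assms(11)])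
    (use assms(1-10) in \<open>auto intro!: tensor_map_hom tensor_module simp: tensor_map_pure\<close>)

lemma tensor_map_id_comp:
  assumes "module K L" "module K M" "module K N" "module K P"
    and f: "f \<in> module_hom K M N" and g: "g \<in> module_hom K N P"
    and x: "x \<in> carrier (L \<Otimes>[K] M)"
  shows "tensor_map K L N L P id g (tensor_map K L M L N id f x) =
    tensor_map K L M L P id (g \<circ> f) x"
  using tensor_map_comp[OF assms(1,2,1,3,1,4) module_hom_id f module_hom_id g x] by simp

section \<open>Coherence of the associators\<close>

lemma associator_natural:
  assumes "module K L" "module K M" "module K N" "module K P" "module K Q" "module K R"
    and f: "f \<in> module_hom K L P" and g: "g \<in> module_hom K M Q" and h: "h \<in> module_hom K N R"
    and z: "z \<in> carrier ((L \<Otimes>[K] M) \<Otimes>[K] N)"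
  shows "tensor_map K L (M \<Otimes>[K] N) P (Q \<Otimes>[K] R) f (tensor_map K M N Q R g h)
      (associator K L M N z) =
    associator K P Q R
      (tensor_map K (L \<Otimes>[K] M) N (P \<Otimes>[K] Q) R (tensor_map K L M P Q f g) h z)"
proof -
  note [simp] = assms(1-9) tensor_module pure_tensor_hom(3) module_hom_closed[OF f]
    module_hom_closed[OF g] module_hom_closed[OF h] tensor_map_hom tensor_map_pure
    associator_hom associator_pure
  let ?l = "tensor_map K L (M \<Otimes>[K] N) P (Q \<Otimes>[K] R) f (tensor_map K M N Q R g h) \<circ> associator K L M N"
    and ?r = "associator K P Q R \<circ> tensor_map K (L \<Otimes>[K] M) N (P \<Otimes>[K] Q) R (tensor_map K L M P Q f g) h"
  have l: "?l \<in> module_hom K ((L \<Otimes>[K] M) \<Otimes>[K] N) (P \<Otimes>[K] (Q \<Otimes>[K] R))"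
    by (rule module_hom_comp[OF associator_hom]) simp_all
  have r: "?r \<in> module_hom K ((L \<Otimes>[K] M) \<Otimes>[K] N) (P \<Otimes>[K] (Q \<Otimes>[K] R))"
    by (rule module_hom_comp[OF tensor_map_hom]) simp_all
  have "?l z = ?r z"
    by (rule tensor_hom_eqI_left[of K L M N "P \<Otimes>[K] (Q \<Otimes>[K] R)", OF _ _ _ _ l r])
      (simp_all add: z)
  then show ?thesis by simp
qed

lemma associator_inv_associator:
  assumes "module K L" "module K M" "module K N" and z: "z \<in> carrier ((L \<Otimes>[K] M) \<Otimes>[K] N)"
  shows "associator_inv K L M N (associator K L M N z) = z"
proof -
  note [simp] = assms(1-3) tensor_module pure_tensor_hom(3)
  have l: "associator_inv K L M N \<circ> associator K L M N
      \<in> module_hom K ((L \<Otimes>[K] M) \<Otimes>[K] N) ((L \<Otimes>[K] M) \<Otimes>[K] N)"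
    by (rule module_hom_comp[OF associator_hom associator_inv_hom]) simp_all
  have "(associator_inv K L M N \<circ> associator K L M N) z = id z"
    by (rule tensor_hom_eqI_left[of K L M N "(L \<Otimes>[K] M) \<Otimes>[K] N", OF _ _ _ _ l module_hom_id])
      (simp_all add: z module_hom_id associator_pure associator_inv_pure)
  then show ?thesis by simp
qed

text \<open>The pentagon identity, with the first two factors carrying a tensor \<open>t\<close> that need not be
  pure: \<open>t\<close> will be a value of an arbitrary linear map into \<open>L \<otimes> M\<close>. Both sides are linear in \<open>t\<close>,
  so it is enough to compare them for pure \<open>t\<close>.\<close>

lemma associator_pentagon:
  assumes "module K L" "module K M" "module K N" "module K X"
    and t: "t \<in> carrier (L \<Otimes>[K] M)" and n: "n \<in> carrier N" and x: "x \<in> carrier X"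
  shows "tensor_map K L ((M \<Otimes>[K] N) \<Otimes>[K] X) L (M \<Otimes>[K] (N \<Otimes>[K] X)) id (associator K M N X)
      (associator K L (M \<Otimes>[K] N) X
        (pure_tensor K (L \<Otimes>[K] (M \<Otimes>[K] N)) X
          (associator K L M N (pure_tensor K (L \<Otimes>[K] M) N t n)) x)) =
    associator K L M (N \<Otimes>[K] X) (pure_tensor K (L \<Otimes>[K] M) (N \<Otimes>[K] X) t (pure_tensor K N X n x))"
proof -
  note [simp] = assms(1-4) n x tensor_module module_hom_id pure_tensor_hom
    associator_hom associator_pure tensor_map_hom tensor_map_pure
  let ?T = "L \<Otimes>[K] (M \<Otimes>[K] (N \<Otimes>[K] X))"
  let ?l = "tensor_map K L ((M \<Otimes>[K] N) \<Otimes>[K] X) L (M \<Otimes>[K] (N \<Otimes>[K] X)) id (associator K M N X) \<circ>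
      (associator K L (M \<Otimes>[K] N) X \<circ>
        ((\<lambda>y. pure_tensor K (L \<Otimes>[K] (M \<Otimes>[K] N)) X y x) \<circ>
          (associator K L M N \<circ> (\<lambda>t. pure_tensor K (L \<Otimes>[K] M) N t n))))"
  let ?r = "associator K L M (N \<Otimes>[K] X) \<circ>
      (\<lambda>t. pure_tensor K (L \<Otimes>[K] M) (N \<Otimes>[K] X) t (pure_tensor K N X n x))"
  have l: "?l \<in> module_hom K (L \<Otimes>[K] M) ?T"
    by (rule module_hom_comp[OF _ tensor_map_hom] module_hom_comp[OF _ associator_hom]
        module_hom_comp[OF _ pure_tensor_hom(2)] | simp)+
  have r: "?r \<in> module_hom K (L \<Otimes>[K] M) ?T"
    by (rule module_hom_comp[OF _ associator_hom]) simp_all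
  have "?l t = ?r t"
    by (rule tensor_hom_eqI[of K L M ?T, OF _ _ _ l r])
      (simp_all add: t)
  then show ?thesis by simp
qed

section \<open>Linear maps acting on the first two tensor factors\<close>

text \<open>The map \<open>f \<otimes> id\<close> from \<open>L \<otimes> M \<otimes> X\<close> to \<open>P \<otimes> Q \<otimes> X\<close>, transported to the bracketing to the
  right.\<close>

definition front_map where
  "front_map K L M P Q X f =
    associator K P Q X \<circ> tensor_map K (L \<Otimes>[K] M) X (P \<Otimes>[K] Q) X f id \<circ> associator_inv K L M X"

lemma
  assumes "module K L" "module K M" "module K P" "module K Q" "module K X"
    and "f \<in> module_hom K (L \<Otimes>[K] M) (P \<Otimes>[K] Q)"
  shows front_map_hom: "front_map K L M P Q X f \<in>
      module_hom K (L \<Otimes>[K] (M \<Otimes>[K] X)) (P \<Otimes>[K] (Q \<Otimes>[K] X))"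
    and front_map_pure: "\<And>l m x. l \<in> carrier L \<Longrightarrow> m \<in> carrier M \<Longrightarrow> x \<in> carrier X \<Longrightarrow>
      front_map K L M P Q X f (pure_tensor K L (M \<Otimes>[K] X) l (pure_tensor K M X m x)) =
      associator K P Q X (pure_tensor K (P \<Otimes>[K] Q) X (f (pure_tensor K L M l m)) x)"
proof -
  note [simp] = assms tensor_module
  show "front_map K L M P Q X f \<in>
      module_hom K (L \<Otimes>[K] (M \<Otimes>[K] X)) (P \<Otimes>[K] (Q \<Otimes>[K] X))"
    unfolding front_map_def
    by (intro module_hom_comp[OF associator_inv_hom] module_hom_comp[OF tensor_map_hom]
        associator_hom module_hom_id) simp_all
  show "front_map K L M P Q X f (pure_tensor K L (M \<Otimes>[K] X) l (pure_tensor K M X m x)) =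
      associator K P Q X (pure_tensor K (P \<Otimes>[K] Q) X (f (pure_tensor K L M l m)) x)"
    if "l \<in> carrier L" "m \<in> carrier M" "x \<in> carrier X" for l m x
    using that by (simp add: front_map_def associator_inv_pure tensor_map_pure module_hom_id
        pure_tensor_hom(3))
qed

text \<open>A map on the first two factors and a map on the last factor commute. Since \<open>f\<close> takes pure
  tensors to arbitrary elements of \<open>P \<otimes> Q\<close>, the proof first needs the effect of \<open>g\<close> on an
  associated \<open>t \<otimes> x\<close> with \<open>t\<close> not necessarily pure.\<close>

lemma front_map_interchange:
  assumes "module K L" "module K M" "module K P" "module K Q" "module K X" "module K Y"
    and f: "f \<in> module_hom K (L \<Otimes>[K] M) (P \<Otimes>[K] Q)" and g: "g \<in> module_hom K X Y"
    and z: "z \<in> carrier (L \<Otimes>[K] (M \<Otimes>[K] X))"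
  shows "tensor_map K P (Q \<Otimes>[K] X) P (Q \<Otimes>[K] Y) id (tensor_map K Q X Q Y id g)
      (front_map K L M P Q X f z) =
    front_map K L M P Q Y f
      (tensor_map K L (M \<Otimes>[K] X) L (M \<Otimes>[K] Y) id (tensor_map K M X M Y id g) z)"
proof -
  note [simp] = assms(1-8) tensor_module module_hom_id pure_tensor_hom(3)
    module_hom_closed[OF f] module_hom_closed[OF g] tensor_map_hom tensor_map_pure
    associator_hom associator_pure front_map_hom front_map_pure
  let ?g = "\<lambda>A B. tensor_map K A (B \<Otimes>[K] X) A (B \<Otimes>[K] Y) id (tensor_map K B X B Y id g)"
  have *: "?g P Q (associator K P Q X (pure_tensor K (P \<Otimes>[K] Q) X t x)) =
      associator K P Q Y (pure_tensor K (P \<Otimes>[K] Q) Y t (g x))"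
    if t: "t \<in> carrier (P \<Otimes>[K] Q)" and x: "x \<in> carrier X" for t x
  proof -
    have l: "?g P Q \<circ> associator K P Q X
        \<in> module_hom K ((P \<Otimes>[K] Q) \<Otimes>[K] X) (P \<Otimes>[K] (Q \<Otimes>[K] Y))"
      by (rule module_hom_comp[OF associator_hom]) simp_all
    have r: "associator K P Q Y \<circ> tensor_map K (P \<Otimes>[K] Q) X (P \<Otimes>[K] Q) Y id g
        \<in> module_hom K ((P \<Otimes>[K] Q) \<Otimes>[K] X) (P \<Otimes>[K] (Q \<Otimes>[K] Y))"
      by (rule module_hom_comp[OF tensor_map_hom]) simp_all
    have "(?g P Q \<circ> associator K P Q X) (pure_tensor K (P \<Otimes>[K] Q) X t x) =
        (associator K P Q Y \<circ> tensor_map K (P \<Otimes>[K] Q) X (P \<Otimes>[K] Q) Y id g)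
          (pure_tensor K (P \<Otimes>[K] Q) X t x)"
      by (rule tensor_hom_eqI_left[of K P Q X "P \<Otimes>[K] (Q \<Otimes>[K] Y)", OF _ _ _ _ l r])
        (simp_all add: t x)
    then show ?thesis
      using t x by simp
  qed
  have l: "?g P Q \<circ> front_map K L M P Q X f
      \<in> module_hom K (L \<Otimes>[K] (M \<Otimes>[K] X)) (P \<Otimes>[K] (Q \<Otimes>[K] Y))"
    by (rule module_hom_comp[OF front_map_hom]) simp_all
  have r: "front_map K L M P Q Y f \<circ> ?g L M
      \<in> module_hom K (L \<Otimes>[K] (M \<Otimes>[K] X)) (P \<Otimes>[K] (Q \<Otimes>[K] Y))"
    by (rule module_hom_comp[OF tensor_map_hom]) simp_all
  have "(?g P Q \<circ> front_map K L M P Q X f) z = (front_map K L M P Q Y f \<circ> ?g L M) z"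
    by (rule tensor_hom_eqI_right[of K L M X "P \<Otimes>[K] (Q \<Otimes>[K] Y)", OF _ _ _ _ l r])
      (simp_all add: z *)
  then show ?thesis by simp
qed

lemma front_map_comp:
  assumes "module K L" "module K M" "module K P" "module K Q" "module K R" "module K S" "module K X"
    and f: "f \<in> module_hom K (L \<Otimes>[K] M) (P \<Otimes>[K] Q)" and g: "g \<in> module_hom K (P \<Otimes>[K] Q) (R \<Otimes>[K] S)"
    and z: "z \<in> carrier (L \<Otimes>[K] (M \<Otimes>[K] X))"
  shows "front_map K L M R S X (g \<circ> f) z = front_map K P Q R S X g (front_map K L M P Q X f z)"
proof -
  note [simp] = assms(1-9) tensor_module module_hom_id
  let ?y = "associator_inv K L M X z"
  have y: "?y \<in> carrier ((L \<Otimes>[K] M) \<Otimes>[K] X)"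
    by (rule module_hom_closed[OF associator_inv_hom z]) simp_all
  have "tensor_map K (L \<Otimes>[K] M) X (P \<Otimes>[K] Q) X f id ?y \<in> carrier ((P \<Otimes>[K] Q) \<Otimes>[K] X)"
    by (rule module_hom_closed[OF tensor_map_hom y]) simp_all
  then show ?thesis
    using y by (simp add: front_map_def associator_inv_associator tensor_map_comp)
qed

text \<open>Tensoring a map on the first two factors of \<open>L \<otimes> M \<otimes> N\<close> with \<open>X\<close> gives, up to brackets, the
  same map on the first two factors of \<open>L \<otimes> M \<otimes> (N \<otimes> X)\<close>. On pure tensors this is the pentagon
  identity for \<open>t = f (l \<otimes> m)\<close>.\<close>

lemma front_map_rebracket:
  assumes "module K L" "module K M" "module K P" "module K Q" "module K N" "module K X"
    and f: "f \<in> module_hom K (L \<Otimes>[K] M) (P \<Otimes>[K] Q)"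
    and z: "z \<in> carrier ((L \<Otimes>[K] (M \<Otimes>[K] N)) \<Otimes>[K] X)"
  shows "tensor_map K P ((Q \<Otimes>[K] N) \<Otimes>[K] X) P (Q \<Otimes>[K] (N \<Otimes>[K] X)) id (associator K Q N X)
      (associator K P (Q \<Otimes>[K] N) X
        (tensor_map K (L \<Otimes>[K] (M \<Otimes>[K] N)) X (P \<Otimes>[K] (Q \<Otimes>[K] N)) X
          (front_map K L M P Q N f) id z)) =
    front_map K L M P Q (N \<Otimes>[K] X) f
      (tensor_map K L ((M \<Otimes>[K] N) \<Otimes>[K] X) L (M \<Otimes>[K] (N \<Otimes>[K] X)) id (associator K M N X)
        (associator K L (M \<Otimes>[K] N) X z))"
proof -
  note [simp] = assms(1-7) tensor_module module_hom_id pure_tensor_hom(3)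
    module_hom_closed[OF f] tensor_map_hom tensor_map_pure
    associator_hom associator_pure front_map_hom front_map_pure associator_pentagon
  let ?S = "(L \<Otimes>[K] (M \<Otimes>[K] N)) \<Otimes>[K] X" and ?T = "P \<Otimes>[K] (Q \<Otimes>[K] (N \<Otimes>[K] X))"
  let ?a = "\<lambda>A B. tensor_map K A ((B \<Otimes>[K] N) \<Otimes>[K] X) A (B \<Otimes>[K] (N \<Otimes>[K] X)) id (associator K B N X)
      \<circ> associator K A (B \<Otimes>[K] N) X"
  let ?F = "tensor_map K (L \<Otimes>[K] (M \<Otimes>[K] N)) X (P \<Otimes>[K] (Q \<Otimes>[K] N)) X (front_map K L M P Q N f) id"
  let ?l = "?a P Q \<circ> ?F" and ?r = "front_map K L M P Q (N \<Otimes>[K] X) f \<circ> ?a L M"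
  have a: "?a P Q \<in> module_hom K ((P \<Otimes>[K] (Q \<Otimes>[K] N)) \<Otimes>[K] X) ?T"
    by (rule module_hom_comp[OF associator_hom]) simp_all
  have a': "?a L M \<in> module_hom K ?S (L \<Otimes>[K] (M \<Otimes>[K] (N \<Otimes>[K] X)))"
    by (rule module_hom_comp[OF associator_hom]) simp_all
  have l: "?l \<in> module_hom K ?S ?T"
    by (rule module_hom_comp[OF _ a]) simp
  have r: "?r \<in> module_hom K ?S ?T"
    by (rule module_hom_comp[OF a']) simp
  have "?l z = ?r z"
  proof (rule tensor_hom_eqI[of K "L \<Otimes>[K] (M \<Otimes>[K] N)" X ?T, OF _ _ _ l r _ z])
    fix y x assume y: "y \<in> carrier (L \<Otimes>[K] (M \<Otimes>[K] N))" and x [simp]: "x \<in> carrier X"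
    let ?p = "\<lambda>y. pure_tensor K (L \<Otimes>[K] (M \<Otimes>[K] N)) X y x"
    have p: "?p \<in> module_hom K (L \<Otimes>[K] (M \<Otimes>[K] N)) ?S"
      by (rule pure_tensor_hom(2)) simp_all
    have "(?l \<circ> ?p) y = (?r \<circ> ?p) y"
      by (rule tensor_hom_eqI_right[of K L M N ?T, OF _ _ _ _ module_hom_comp[OF p l]
          module_hom_comp[OF p r] _ y]) simp_all
    then show "?l (?p y) = ?r (?p y)"
      by simp
  qed simp_all
  then show ?thesis
    by simp
qed

text \<open>The colinearity hypothesis says that \<open>f\<close> commutes with \<open>id \<otimes> d\<close>, where \<open>f\<close> acts on the first
  two factors once \<open>d\<close> has split off \<open>N\<close>. The conclusion is the same statement with a spectator
  factor \<open>X\<close>; \<open>\<rho>\<close> is \<open>id \<otimes> d \<otimes> id\<close> followed by the bracketing to the right. Naturality of the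
  associator rewrites \<open>\<rho>\<close> as \<open>(id \<otimes> d) \<otimes> id\<close> followed by associators. There the hypothesis applies,
  and \<open>front_map_rebracket\<close> carries the result back.\<close>

lemma front_map_coaction:
  assumes "module K L" "module K M" "module K N" "module K X"
    and f: "f \<in> module_hom K (L \<Otimes>[K] M) (L \<Otimes>[K] M)" and d: "d \<in> module_hom K M (M \<Otimes>[K] N)"
    and colinear: "\<And>y. y \<in> carrier (L \<Otimes>[K] M) \<Longrightarrow>
      tensor_map K L M L (M \<Otimes>[K] N) id d (f y) =
      front_map K L M L M N f (tensor_map K L M L (M \<Otimes>[K] N) id d y)"
    and v: "v \<in> carrier ((L \<Otimes>[K] M) \<Otimes>[K] X)"
  defines "\<rho> \<equiv> \<lambda>v. tensor_map K L ((M \<Otimes>[K] N) \<Otimes>[K] X) L (M \<Otimes>[K] (N \<Otimes>[K] X)) id (associator K M N X)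
      (tensor_map K L (M \<Otimes>[K] X) L ((M \<Otimes>[K] N) \<Otimes>[K] X) id (tensor_map K M X (M \<Otimes>[K] N) X d id)
        (associator K L M X v))"
  shows "\<rho> (tensor_map K (L \<Otimes>[K] M) X (L \<Otimes>[K] M) X f id v) =
    front_map K L M L M (N \<Otimes>[K] X) f (\<rho> v)"
proof -
  note [simp] = assms(1-4) f d tensor_module module_hom_id
  let ?LM = "L \<Otimes>[K] M" and ?LMN = "L \<Otimes>[K] (M \<Otimes>[K] N)"
  let ?d = "tensor_map K L M L (M \<Otimes>[K] N) id d"
  let ?D = "tensor_map K ?LM X ?LMN X ?d id"
    and ?F = "tensor_map K ?LM X ?LM X f id"
    and ?G = "tensor_map K ?LMN X ?LMN X (front_map K L M L M N f) id"
  let ?a = "\<lambda>z. tensor_map K L ((M \<Otimes>[K] N) \<Otimes>[K] X) L (M \<Otimes>[K] (N \<Otimes>[K] X)) id (associator K M N X)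
      (associator K L (M \<Otimes>[K] N) X z)"
  have dh: "?d \<in> module_hom K ?LM ?LMN" and fh: "front_map K L M L M N f \<in> module_hom K ?LMN ?LMN"
    by (simp_all add: tensor_map_hom front_map_hom)
  have \<rho>: "\<rho> z = ?a (?D z)" if "z \<in> carrier (?LM \<Otimes>[K] X)" for z
    using that by (simp add: \<rho>_def associator_natural)
  have Fv: "?F v \<in> carrier (?LM \<Otimes>[K] X)" and Dv: "?D v \<in> carrier (?LMN \<Otimes>[K] X)"
    by (rule module_hom_closed[OF tensor_map_hom v]; simp add: dh)+
  have "?D (?F v) = tensor_map K ?LM X ?LMN X (?d \<circ> f) id v"
    using tensor_map_comp[of K ?LM X ?LM X ?LMN X, OF _ _ _ _ _ _ f module_hom_id dh module_hom_id v]
    by simp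
  also have "\<dots> = tensor_map K ?LM X ?LMN X (front_map K L M L M N f \<circ> ?d) id v"
    by (rule tensor_map_cong[OF _ _ _ _ module_hom_comp[OF f dh] module_hom_comp[OF dh fh]
          module_hom_id module_hom_id _ _ v]) (simp_all add: colinear)
  also have "\<dots> = ?G (?D v)"
    using tensor_map_comp[of K ?LM X ?LMN X ?LMN X, OF _ _ _ _ _ _ dh module_hom_id fh module_hom_id v]
    by simp
  finally have "\<rho> (?F v) = ?a (?G (?D v))"
    by (simp add: \<rho> Fv)
  also have "\<dots> = front_map K L M L M (N \<Otimes>[K] X) f (?a (?D v))"
    by (rule front_map_rebracket) (simp_all add: Dv)
  also have "?a (?D v) = \<rho> v"
    by (simp add: \<rho> v)
  finally show ?thesis .
qed

section \<open>Composing a twist map with an element of Tw\<close>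

theorem proposition4p15:
  fixes K :: "('a, 'k) ring_scheme"
    and C :: "('a, 'c, 'e) coalgebra_scheme"
    and D :: "('a, 'd, 'f) coalgebra_scheme"
    and \<chi> :: "('a, 'c, 'd) tensor \<Rightarrow> ('a, 'd, 'c) tensor"
    and \<Psi>' :: "('a, 'd, 'c) tensor \<Rightarrow> ('a, 'd, 'c) tensor"
  assumes "field K"
    and "coalgebra K C"
    and "coalgebra K D"
    and "twist_map K C D \<chi>"
    and "twist_coassociative K C D \<chi>"
    and "\<Psi>' \<in> Tw K C D"
  shows "twist_map K C D (\<Psi>' \<circ> \<chi>) \<and> twist_coassociative K C D (\<Psi>' \<circ> \<chi>)"
proof -
  have [simp]: "module K C" "module K D"
    and c: "comult C \<in> module_hom K C (C \<Otimes>[K] C)" and d: "comult D \<in> module_hom K D (D \<Otimes>[K] D)"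
    using assms(2,3) by (simp_all add: coalgebra_def vectorspace_def coalgebra_axioms_def)
  have \<chi>: "\<chi> \<in> module_hom K (C \<Otimes>[K] D) (D \<Otimes>[K] C)"
    using assms(4) by (simp add: twist_map_def)
  let ?DC = "D \<Otimes>[K] C"
  have \<Psi>: "\<Psi>' \<in> module_hom K ?DC ?DC"
    using assms(6) by (simp add: Tw_def)
  note \<Psi>\<chi> = module_hom_comp[OF \<chi> \<Psi>]
  note [simp] = c d \<chi> \<Psi> \<Psi>\<chi> tensor_module module_hom_id tensor_map_hom associator_hom
    associator_inv_hom front_map_hom
  \<comment> \<open>the left coaction of \<open>D\<close> on \<open>D \<otimes> C\<close>, bracketed to the right\<close>
  define \<theta> where "\<theta> = associator K D D C \<circ> tensor_map K D C (D \<Otimes>[K] D) C (comult D) id"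
  have \<theta>: "\<theta> \<in> module_hom K ?DC (D \<Otimes>[K] ?DC)"
    unfolding \<theta>_def by (rule module_hom_comp[OF tensor_map_hom]) simp_all
  have \<theta>\<Psi>: "\<theta> (\<Psi>' y) = tensor_map K D ?DC D ?DC id \<Psi>' (\<theta> y)" if "y \<in> carrier ?DC" for y
    using assms(6) that by (simp add: Tw_def \<theta>_def)
  have \<Psi>c: "tensor_map K D C D (C \<Otimes>[K] C) id (comult C) (\<Psi>' y) =
      front_map K D C D C C \<Psi>' (tensor_map K D C D (C \<Otimes>[K] C) id (comult C) y)"
    if "y \<in> carrier ?DC" for y
    using assms(6) that by (simp add: Tw_def front_map_def)
  \<comment> \<open>the map \<open>h\<close> applied to the last factor \<open>X\<close> of \<open>A \<otimes> (B \<otimes> X)\<close>\<close>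
  let ?last = "\<lambda>A B X Y h. tensor_map K A (B \<Otimes>[K] X) A (B \<Otimes>[K] Y) id (tensor_map K B X B Y id h)"
  \<comment> \<open>\<open>id \<otimes> \<Delta> \<otimes> id\<close> on \<open>D \<otimes> C \<otimes> D\<close>, bracketed to the right\<close>
  define \<rho> where "\<rho> v = tensor_map K D ((C \<Otimes>[K] C) \<Otimes>[K] D) D (C \<Otimes>[K] (C \<Otimes>[K] D)) id (associator K C C D)
      (tensor_map K D (C \<Otimes>[K] D) D ((C \<Otimes>[K] C) \<Otimes>[K] D) id (tensor_map K C D (C \<Otimes>[K] C) D (comult C) id)
        (associator K D C D v))" for v
  \<comment> \<open>The two sides of the coassociativity condition as functions of the twist map \<open>f\<close>; \<open>u\<close> and
      \<open>s\<close> are what is done to \<open>x\<close> before \<open>f\<close> is first applied.\<close>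
  define u where "u x = associator_inv K C D D (tensor_map K C D C (D \<Otimes>[K] D) id (comult D) x)" for x
  define s where "s x = associator K C C D (tensor_map K C D (C \<Otimes>[K] C) D (comult C) id x)" for x
  define lhs where "lhs f x = ?last D C (C \<Otimes>[K] D) ?DC f
      (\<rho> (tensor_map K (C \<Otimes>[K] D) D ?DC D f id (u x)))" for f x
  define rhs where "rhs f x = front_map K C D D C ?DC f
      (tensor_map K C ?DC C (D \<Otimes>[K] ?DC) id \<theta> (tensor_map K C (C \<Otimes>[K] D) C ?DC id f (s x)))" for f x
  have u: "u x \<in> carrier ((C \<Otimes>[K] D) \<Otimes>[K] D)" and s: "s x \<in> carrier (C \<Otimes>[K] (C \<Otimes>[K] D))"
    if "x \<in> carrier (C \<Otimes>[K] D)" for x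
    unfolding u_def s_def using that
    by (auto intro!: module_hom_closed[OF associator_inv_hom] module_hom_closed[OF associator_hom]
        module_hom_closed[OF tensor_map_hom])
  have coassociative_iff: "twist_coassociative K C D f \<longleftrightarrow>
      (\<forall>x\<in>carrier (C \<Otimes>[K] D). lhs f x = rhs f x)"
    if f: "f \<in> module_hom K (C \<Otimes>[K] D) ?DC" for f
  proof -
    have "tensor_map K C ((D \<Otimes>[K] D) \<Otimes>[K] C) C (D \<Otimes>[K] ?DC) id (associator K D D C)
        (tensor_map K C ?DC C ((D \<Otimes>[K] D) \<Otimes>[K] C) id (tensor_map K D C (D \<Otimes>[K] D) C (comult D) id)
          (tensor_map K C (C \<Otimes>[K] D) C ?DC id f (s x))) =
      tensor_map K C ?DC C (D \<Otimes>[K] ?DC) id \<theta> (tensor_map K C (C \<Otimes>[K] D) C ?DC id f (s x))"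
      if x: "x \<in> carrier (C \<Otimes>[K] D)" for x
      unfolding \<theta>_def
      by (rule tensor_map_id_comp) (simp_all add: f module_hom_closed[OF tensor_map_hom s[OF x]])
    then show ?thesis
      unfolding twist_coassociative_def lhs_def rhs_def \<rho>_def u_def front_map_def
      by (simp add: s_def)
  qed
  \<comment> \<open>On each side both copies of \<open>\<Psi>'\<close> are moved to the outside. The order, last two factors before
      first two, is the same on both sides, so that the hypothesis on \<open>\<chi>\<close> can be substituted.\<close>
  have lhs: "lhs (\<Psi>' \<circ> \<chi>) x = front_map K D C D C ?DC \<Psi>' (?last D C ?DC ?DC \<Psi>' (lhs \<chi> x))"
    if x: "x \<in> carrier (C \<Otimes>[K] D)" for x
  proof -
    let ?v = "tensor_map K (C \<Otimes>[K] D) D ?DC D \<chi> id (u x)"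
    have v: "?v \<in> carrier (?DC \<Otimes>[K] D)"
      by (rule module_hom_closed[OF tensor_map_hom u[OF x]]) simp_all
    have \<rho>v: "\<rho> ?v \<in> carrier (D \<Otimes>[K] (C \<Otimes>[K] (C \<Otimes>[K] D)))"
      unfolding \<rho>_def
      by (intro module_hom_closed[OF tensor_map_hom] module_hom_closed[OF associator_hom] v) simp_all
    have "\<rho> (tensor_map K (C \<Otimes>[K] D) D ?DC D (\<Psi>' \<circ> \<chi>) id (u x)) =
        \<rho> (tensor_map K ?DC D ?DC D \<Psi>' id ?v)"
      using tensor_map_comp[of K "C \<Otimes>[K] D" D ?DC D ?DC D, OF _ _ _ _ _ _ \<chi> module_hom_id \<Psi>
          module_hom_id u[OF x]] by simp
    also have "\<dots> = front_map K D C D C (C \<Otimes>[K] D) \<Psi>' (\<rho> ?v)"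
      unfolding \<rho>_def by (rule front_map_coaction) (simp_all add: \<Psi>c v)
    finally have "lhs (\<Psi>' \<circ> \<chi>) x =
        front_map K D C D C ?DC \<Psi>' (?last D C (C \<Otimes>[K] D) ?DC (\<Psi>' \<circ> \<chi>) (\<rho> ?v))"
      by (simp add: lhs_def front_map_interchange \<rho>v)
    also have "?last D C (C \<Otimes>[K] D) ?DC (\<Psi>' \<circ> \<chi>) (\<rho> ?v) =
        tensor_map K D (C \<Otimes>[K] (C \<Otimes>[K] D)) D (C \<Otimes>[K] ?DC) id
          (tensor_map K C ?DC C ?DC id \<Psi>' \<circ> tensor_map K C (C \<Otimes>[K] D) C ?DC id \<chi>) (\<rho> ?v)"
      by (rule tensor_map_cong[OF _ _ _ _ module_hom_id module_hom_id tensor_map_hom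
            module_hom_comp[OF tensor_map_hom tensor_map_hom] _ _ \<rho>v])
        (simp_all add: tensor_map_id_comp)
    also have "\<dots> = ?last D C ?DC ?DC \<Psi>' (lhs \<chi> x)"
      unfolding lhs_def by (rule tensor_map_id_comp[symmetric]) (simp_all add: \<rho>v)
    finally show ?thesis .
  qed
  have rhs: "rhs (\<Psi>' \<circ> \<chi>) x = front_map K D C D C ?DC \<Psi>' (?last D C ?DC ?DC \<Psi>' (rhs \<chi> x))"
    if x: "x \<in> carrier (C \<Otimes>[K] D)" for x
  proof -
    let ?y = "tensor_map K C (C \<Otimes>[K] D) C ?DC id \<chi> (s x)"
    let ?z = "tensor_map K C ?DC C (D \<Otimes>[K] ?DC) id \<theta> ?y"
    have y: "?y \<in> carrier (C \<Otimes>[K] ?DC)"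
      by (rule module_hom_closed[OF tensor_map_hom s[OF x]]) simp_all
    have z: "?z \<in> carrier (C \<Otimes>[K] (D \<Otimes>[K] ?DC))"
      by (rule module_hom_closed[OF tensor_map_hom y]) (simp_all add: \<theta>)
    have Iz: "?last C D ?DC ?DC \<Psi>' ?z \<in> carrier (C \<Otimes>[K] (D \<Otimes>[K] ?DC))"
      by (rule module_hom_closed[OF tensor_map_hom z]) simp_all
    have "tensor_map K C ?DC C (D \<Otimes>[K] ?DC) id \<theta>
          (tensor_map K C (C \<Otimes>[K] D) C ?DC id (\<Psi>' \<circ> \<chi>) (s x)) =
        tensor_map K C ?DC C (D \<Otimes>[K] ?DC) id \<theta> (tensor_map K C ?DC C ?DC id \<Psi>' ?y)"
      by (simp add: tensor_map_id_comp s[OF x])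
    also have "\<dots> = tensor_map K C ?DC C (D \<Otimes>[K] ?DC) id (\<theta> \<circ> \<Psi>') ?y"
      by (rule tensor_map_id_comp) (simp_all add: \<theta> y)
    also have "\<dots> = tensor_map K C ?DC C (D \<Otimes>[K] ?DC) id (tensor_map K D ?DC D ?DC id \<Psi>' \<circ> \<theta>) ?y"
      by (rule tensor_map_cong[OF _ _ _ _ module_hom_id module_hom_id module_hom_comp[OF \<Psi> \<theta>]
            module_hom_comp[OF \<theta> tensor_map_hom] _ _ y]) (simp_all add: \<theta>\<Psi>)
    also have "\<dots> = ?last C D ?DC ?DC \<Psi>' ?z"
      by (rule tensor_map_id_comp[symmetric]) (simp_all add: \<theta> y)
    finally have "rhs (\<Psi>' \<circ> \<chi>) x = front_map K C D D C ?DC (\<Psi>' \<circ> \<chi>) (?last C D ?DC ?DC \<Psi>' ?z)"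
      by (simp add: rhs_def)
    also have "\<dots> = front_map K D C D C ?DC \<Psi>'
        (front_map K C D D C ?DC \<chi> (?last C D ?DC ?DC \<Psi>' ?z))"
      by (rule front_map_comp) (simp_all add: Iz)
    also have "front_map K C D D C ?DC \<chi> (?last C D ?DC ?DC \<Psi>' ?z) = ?last D C ?DC ?DC \<Psi>' (rhs \<chi> x)"
      unfolding rhs_def by (rule front_map_interchange[symmetric]) (simp_all add: z)
    finally show ?thesis .
  qed
  show ?thesis
    using assms(5) by (simp add: twist_map_def coassociative_iff lhs rhs)
qed

end
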